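(* Let $n\ge4$, let $1\le k\le n-3$, let $g\in\mathfrak M_n$ be a metric on $F(n)$ of the form $g=ds^2_{\Lambda}$ with $\Lambda$ of type $\Lambda^k$, and let $M^2$ be a closed Riemann surface equipped with a Hermitian (hence Kähler) metric. If $\phi:M^2\to (F(n),g)$ is holomorphic with respect to the complex structure of $M^2$ and the almost complex structure $J_k$ on $F(n)$, then $\phi$ is harmonic.
   Context: $F(n)=U(n)/T$, where $T=U(1)\times\cdots\times U(1)$ ($n$ factors) is the diagonal maximal torus of $U(n)$; $U(n)$ acts on the left. The tangent space at the base point is identified with $\mathfrak p=\{A=(a_{ij})\in\mathfrak u(n): a_{ii}=0\text{ for all }i\}$. Almost complex structure $J_k$ ($1\le k\le n-3$): the $U(n)$-invariant almost complex structure on $F(n)$ given on $\mathfrak p$ by $J_k(a_{ij})=(a'_{ij})$, where for $i<j$: $a'_{ij}=-\sqrt{-1}\,a_{ij}$ if $j=n$ and $i\le k$, and $a'_{ij}=\sqrt{-1}\,a_{ij}$ otherwise. (Its associated tournament has $n\to 1,\dots,n\to k$ and $i\to j$ for all other $i<j$.) Invariant metrics: for a real symmetric matrix $\Lambda=(\lambda_{ij})$ with $\lambda_{ij}>0$ for $i\ne j$ and $\lambda_{ii}=0$, $ds^2_\Lambda$ is the $U(n)$-invariant Riemannian metric on $F(n)$ given on $\mathfrak p$ by $ds^2_\Lambda(A,B)=\sum_{i,j}\lambda_{ij}a_{ij}\overline{b_{ij}}$. Type $\Lambda^k$: $\Lambda$ is of type $\Lambda^k$ if $\lambda_{ij}=\lambda_{i(i+1)}+\lambda_{(i+1)(i+2)}+\cdots+\lambda_{(j-1)j}$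 for all $1\le i<j\le n$ except the pairs $(1,n),\dots,(k,n)$, and $\lambda_{in}=\lambda_{12}+\lambda_{23}+\cdots+\lambda_{(i-1)i}+\lambda_{1n}$ for $2\le i\le k$. $\mathfrak M_n=\{g^k=ds^2_{\Lambda^k}:1\le k\le n-3\}$ is the set of all metrics $ds^2_\Lambda$ with $\Lambda$ of type $\Lambda^k$ for some $1\le k\le n-3$. A map $\phi$ between almost complex manifolds $(M,J_1)$ and $(N,J_2)$ is holomorphic if $d\phi\circ J_1=J_2\circ d\phi$. Harmonic means that the tension field of $\phi$ vanishes. *)

theory Defs
  imports "HOL-Complex_Analysis.Complex_Analysis"
begin

section \<open>Smooth maps and Riemannian geometry in coordinates\<close>

text \<open>Derivatives are only ever taken at points of open sets, so that
  \<^const>\<open>frechet_derivative\<close> is the ordinary differential.\<close>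

primrec Ck_on :: "nat \<Rightarrow> ('a::euclidean_space \<Rightarrow> 'b::real_normed_vector) \<Rightarrow> 'a set \<Rightarrow> bool" where
  "Ck_on 0 f S \<longleftrightarrow> continuous_on S f"
| "Ck_on (Suc r) f S \<longleftrightarrow> (\<forall>x\<in>S. f differentiable (at x)) \<and>
      (\<forall>v. Ck_on r (\<lambda>x. frechet_derivative f (at x) v) S)"

definition smooth_on :: "'a::euclidean_space set \<Rightarrow> ('a \<Rightarrow> 'b::real_normed_vector) \<Rightarrow> bool" where
  "smooth_on S f \<longleftrightarrow> (\<forall>r. Ck_on r f S)"

abbreviation Df :: "('a::real_normed_vector \<Rightarrow> 'b::real_normed_vector) \<Rightarrow> 'a \<Rightarrow> 'a \<Rightarrow> 'b" where
  "Df f x \<equiv> frechet_derivative f (at x)"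

text \<open>A metric in coordinates is a function \<open>h\<close> with \<open>h x v w\<close> the inner product of the tangent
  vectors \<open>v\<close>, \<open>w\<close> at \<open>x\<close>.  The coordinate space is a linear subspace \<open>E\<close> of a Euclidean space
  (the coordinate expressions may be defined on an open set of the surrounding space, but only
  directions in \<open>E\<close> are used).  The Christoffel symbols of the Levi-Civita connection are the
  bilinear map \<open>(v, w) \<mapsto> \<Gamma>\<^sub>x(v, w)\<close> given by the Koszul formula for constant vector fields.\<close>

definition christoffel ::
  "'a::euclidean_space set \<Rightarrow> ('a \<Rightarrow> 'a \<Rightarrow> 'a \<Rightarrow> real) \<Rightarrow> 'a \<Rightarrow> 'a \<Rightarrow> 'a \<Rightarrow> 'a" where
  "christoffel E h x v w = (THE c. c \<in> E \<and> (\<forall>y\<in>E. h x c y =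
      (Df (\<lambda>p. h p w y) x v + Df (\<lambda>p. h p v y) x w - Df (\<lambda>p. h p v w) x y) / 2))"

text \<open>The vector with components \<open>\<Sum>\<^sub>j h\<^sup>i\<^sup>j a\<^sub>j\<close>, where \<open>h\<^sup>i\<^sup>j\<close> is the inverse of the Gram matrix.\<close>

definition raise_index :: "('a::euclidean_space \<Rightarrow> 'a \<Rightarrow> real) \<Rightarrow> 'a \<Rightarrow> 'a" where
  "raise_index h a = (THE c. \<forall>w. h c w = a \<bullet> w)"

text \<open>\<open>(\<nabla>du)(v, w)\<close> for a map \<open>u\<close> from an open set of \<^typ>\<open>'a\<close> with metric \<open>h\<close> to \<open>E\<close> with
  metric \<open>g\<close>.\<close>

definition second_fundamental_form ::
  "'b::euclidean_space set \<Rightarrow> ('a::euclidean_space \<Rightarrow> 'a \<Rightarrow> 'a \<Rightarrow> real) \<Rightarrow> ('b \<Rightarrow> 'b \<Rightarrow> 'b \<Rightarrow> real)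
     \<Rightarrow> ('a \<Rightarrow> 'b) \<Rightarrow> 'a \<Rightarrow> 'a \<Rightarrow> 'a \<Rightarrow> 'b" where
  "second_fundamental_form E h g u x v w =
     Df (\<lambda>p. Df u p w) x v - Df u x (christoffel UNIV h x v w)
       + christoffel E g (u x) (Df u x v) (Df u x w)"

text \<open>The trace \<open>\<Sum>\<^sub>i\<^sub>j h\<^sup>i\<^sup>j (\<nabla>du)(e\<^sub>i, e\<^sub>j)\<close>.\<close>

definition tension ::
  "'b::euclidean_space set \<Rightarrow> ('a::euclidean_space \<Rightarrow> 'a \<Rightarrow> 'a \<Rightarrow> real) \<Rightarrow> ('b \<Rightarrow> 'b \<Rightarrow> 'b \<Rightarrow> real)
     \<Rightarrow> ('a \<Rightarrow> 'b) \<Rightarrow> 'a \<Rightarrow> 'b" where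
  "tension E h g u x =
     (\<Sum>b\<in>Basis. second_fundamental_form E h g u x b (raise_index (h x) b))"


section \<open>Closed Riemann surfaces with a Hermitian metric\<close>

type_synonym 'm chart = "'m set \<times> ('m \<Rightarrow> complex)"

definition holomorphic_atlas :: "'m topology \<Rightarrow> 'm chart set \<Rightarrow> bool" where
  "holomorphic_atlas X \<A> \<longleftrightarrow>
     (\<forall>(U, z)\<in>\<A>. openin X U \<and> open (z ` U) \<and>
        homeomorphic_map (subtopology X U) (top_of_set (z ` U)) z) \<and>
     (\<Union>(U, z)\<in>\<A>. U) = topspace X \<and>
     (\<forall>(U, z)\<in>\<A>. \<forall>(U', z')\<in>\<A>. (z' \<circ> inv_into U z) holomorphic_on z ` (U \<inter> U'))"

definition closed_riemann_surface :: "'m topology \<Rightarrow> 'm chart set \<Rightarrow> bool" where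
  "closed_riemann_surface X \<A> \<longleftrightarrow>
     compact_space X \<and> connected_space X \<and> Hausdorff_space X \<and> holomorphic_atlas X \<A>"

text \<open>A Riemannian metric is the family \<open>h\<close> of its expressions in the charts; the last conjunct
  is the transformation law under a change of chart.\<close>

definition hermitian_metric ::
  "'m chart set \<Rightarrow> ('m chart \<Rightarrow> complex \<Rightarrow> complex \<Rightarrow> complex \<Rightarrow> real) \<Rightarrow> bool" where
  "hermitian_metric \<A> h \<longleftrightarrow>
     (\<forall>(U, z)\<in>\<A>.
        (\<forall>v w. smooth_on (z ` U) (\<lambda>x. h (U, z) x v w)) \<and>
        (\<forall>x\<in>z ` U. bilinear (h (U, z) x) \<and>
           (\<forall>v w. h (U, z) x v w = h (U, z) x w v) \<and>
           (\<forall>v. v \<noteq> 0 \<longrightarrow> h (U, z) x v v > 0) \<and>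
           (\<forall>v w. h (U, z) x (\<i> * v) (\<i> * w) = h (U, z) x v w))) \<and>
     (\<forall>(U, z)\<in>\<A>. \<forall>(U', z')\<in>\<A>. \<forall>x\<in>z ` (U \<inter> U'). \<forall>v w.
        let \<tau> = z' \<circ> inv_into U z
        in h (U, z) x v w = h (U', z') (\<tau> x) (deriv \<tau> x * v) (deriv \<tau> x * w))"


section \<open>The flag manifold\<close>

text \<open>Matrices are indexed by a finite linearly ordered type with \<open>n\<close> elements;
  \<open>pos i\<close> is the place in \<open>{1..n}\<close> of the index \<open>i\<close>.\<close>

type_synonym 'n cmat = "complex^'n^'n"

definition pos :: "'n::{finite,linorder} \<Rightarrow> nat" where
  "pos i = card {j. j \<le> i}"

lemma pos_less_iff: "pos i < pos j \<longleftrightarrow> i < j"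
proof -
  have *: "pos i < pos j" if "i < j" for i j :: 'a
  proof -
    have "{l. l \<le> i} \<subset> {l. l \<le> j}"
      using that by (metis (mono_tags) Collect_mono_iff mem_Collect_eq not_less order.strict_trans2
          order_refl psubsetI less_imp_le)
    then show ?thesis
      unfolding pos_def by (intro psubset_card_mono) auto
  qed
  show ?thesis
    using *[of i j] *[of j i] by (cases i j rule: linorder_cases) auto
qed

lemma bij_betw_pos: "bij_betw (pos :: 'n::{finite,linorder} \<Rightarrow> nat) UNIV {1..CARD('n)}"
proof -
  have inj: "inj (pos :: 'n \<Rightarrow> nat)"
    by (rule injI) (metis linorder_neq_iff pos_less_iff)
  have "pos i \<ge> 1" for i :: 'n
  proof -
    have "i \<in> {j. j \<le> i}" by simp
    then have "card {j. j \<le> i} \<noteq> 0" by (metis card_0_eq empty_iff finite)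
    then show ?thesis unfolding pos_def by linarith
  qed
  moreover have "pos i \<le> CARD('n)" for i :: 'n
    unfolding pos_def by (rule card_mono) auto
  ultimately have "range (pos :: 'n \<Rightarrow> nat) \<subseteq> {1..CARD('n)}"
    by auto
  then have "range (pos :: 'n \<Rightarrow> nat) = {1..CARD('n)}"
    by (intro card_subset_eq) (auto simp: card_image inj)
  with inj show ?thesis
    by (simp add: bij_betw_def)
qed

definition adjoint_mat :: "'n::finite cmat \<Rightarrow> 'n cmat" where
  "adjoint_mat A = (\<chi> i j. cnj (A $ j $ i))"

definition unitary_group :: "'n::finite cmat set" where
  "unitary_group = {A. A ** adjoint_mat A = mat 1 \<and> adjoint_mat A ** A = mat 1}"

definition diagonal_torus :: "'n::finite cmat set" where
  "diagonal_torus = {A \<in> unitary_group. \<forall>i j. i \<noteq> j \<longrightarrow> A $ i $ j = 0}"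

definition torus_coset :: "'n::finite cmat \<Rightarrow> 'n cmat set" where
  "torus_coset A = (\<lambda>t. A ** t) ` diagonal_torus"

definition flag_manifold :: "'n::finite cmat set set" where
  "flag_manifold = torus_coset ` unitary_group"

definition tangent_p :: "'n::finite cmat set" where
  "tangent_p = {A. adjoint_mat A = - A \<and> (\<forall>i. A $ i $ i = 0)}"

definition off_diagonal :: "'n::finite cmat \<Rightarrow> 'n cmat" where
  "off_diagonal A = (\<chi> i j. if i = j then 0 else A $ i $ j)"

subsection \<open>Local coordinates\<close>

text \<open>Let \<open>s\<close> be a smooth map into \<open>U(n)\<close> and \<open>\<pi> : U(n) \<rightarrow> F(n)\<close> the projection.  The derivative of
  \<open>\<pi> \<circ> s\<close> at \<open>x\<close> in the direction \<open>v\<close> is the translate by \<open>s x\<close> of the vector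
  \<open>off_diagonal ((s x)\<^sup>* Ds\<^sub>x v)\<close> of \<open>\<p>\<close>, because the derivative of \<open>\<pi>\<close> at the identity is the
  projection of \<open>\<u>(n)\<close> to \<open>\<p>\<close> along the diagonal matrices.\<close>

definition frame_coord :: "('n::finite cmat \<Rightarrow> 'n cmat) \<Rightarrow> 'n cmat \<Rightarrow> 'n cmat \<Rightarrow> 'n cmat" where
  "frame_coord s x v = off_diagonal (adjoint_mat (s x) ** Df s x v)"

text \<open>A local parametrization of \<open>F(n)\<close> is an injective immersion \<open>\<pi> \<circ> s\<close> of the open subset
  \<open>W \<inter> \<p>\<close> of \<open>\<p>\<close>.  As \<open>dim F(n) = dim \<p>\<close>, it is a diffeomorphism onto an open subset of \<open>F(n)\<close>.
  Since \<open>U(n) \<rightarrow> F(n)\<close> is locally trivial, every chart of \<open>F(n)\<close> arises in this way after shrinking;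
  e.g. \<open>s A = g exp A\<close> near \<open>0\<close>.  Hence these parametrizations define the smooth structure of \<open>F(n)\<close>.\<close>

type_synonym 'n param = "'n cmat set \<times> ('n cmat \<Rightarrow> 'n cmat)"

definition flag_param :: "'n::finite param \<Rightarrow> bool" where
  "flag_param = (\<lambda>(W, s). open W \<and> smooth_on W s \<and>
     (\<forall>x\<in>W \<inter> tangent_p. s x \<in> unitary_group) \<and>
     inj_on (\<lambda>x. torus_coset (s x)) (W \<inter> tangent_p) \<and>
     (\<forall>x\<in>W \<inter> tangent_p. bij_betw (frame_coord s x) tangent_p tangent_p))"

text \<open>Coordinate expressions of the \<open>U(n)\<close>-invariant almost complex structure and of the
  \<open>U(n)\<close>-invariant metric that are given on \<open>\<p>\<close> by \<open>J\<close> and \<open>g\<close>.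
  Another choice of \<open>s\<close> over the same map \<open>\<pi> \<circ> s\<close> conjugates \<open>frame_coord s x\<close> by an element of the
  torus, which commutes with \<open>J_flag k\<close> and preserves \<open>ds2 \<Lambda>\<close> below, as these act entrywise.\<close>

definition invariant_acs ::
  "('n::finite cmat \<Rightarrow> 'n cmat) \<Rightarrow> 'n param \<Rightarrow> 'n cmat \<Rightarrow> 'n cmat \<Rightarrow> 'n cmat" where
  "invariant_acs J = (\<lambda>(W, s) x v.
     inv_into tangent_p (frame_coord s x) (J (frame_coord s x v)))"

definition invariant_metric ::
  "('n::finite cmat \<Rightarrow> 'n cmat \<Rightarrow> real) \<Rightarrow> 'n param \<Rightarrow> 'n cmat \<Rightarrow> 'n cmat \<Rightarrow> 'n cmat \<Rightarrow> real" where
  "invariant_metric g = (\<lambda>(W, s) x v w. g (frame_coord s x v) (frame_coord s x w))"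

subsection \<open>Almost complex structures and metrics\<close>

definition J_upper :: "nat \<Rightarrow> 'n::{finite,linorder} cmat \<Rightarrow> 'n \<Rightarrow> 'n \<Rightarrow> complex" where
  "J_upper k A i j =
     (if pos j = CARD('n) \<and> pos i \<le> k then - \<i> * A $ i $ j else \<i> * A $ i $ j)"

text \<open>The entries below the diagonal are determined by \<open>J\<^sub>k A\<close> being skew-Hermitian.\<close>

definition J_flag :: "nat \<Rightarrow> 'n::{finite,linorder} cmat \<Rightarrow> 'n cmat" where
  "J_flag k A = (\<chi> i j. if i < j then J_upper k A i j
                        else if j < i then - cnj (J_upper k A j i) else 0)"

lemma J_flag_in_tangent_p: "J_flag k A \<in> tangent_p"
  by (auto simp: J_flag_def tangent_p_def adjoint_mat_def vec_eq_iff)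

lemma J_flag_J_flag: "A \<in> tangent_p \<Longrightarrow> J_flag k (J_flag k A) = - A"
proof -
  assume "A \<in> tangent_p"
  then have "cnj (A $ j $ i) = - A $ i $ j" "A $ i $ i = 0" for i j
    by (auto simp: tangent_p_def adjoint_mat_def vec_eq_iff)
  then show ?thesis
    by (auto simp: J_flag_def J_upper_def vec_eq_iff not_less order.strict_iff_order)
qed

text \<open>The matrix \<open>\<Lambda>\<close> has indices in \<open>{1..n}\<close>; other values are irrelevant.\<close>

definition metric_matrix :: "nat \<Rightarrow> (nat \<Rightarrow> nat \<Rightarrow> real) \<Rightarrow> bool" where
  "metric_matrix n \<Lambda> \<longleftrightarrow> (\<forall>i\<in>{1..n}. \<forall>j\<in>{1..n}.
     \<Lambda> i j = \<Lambda> j i \<and> (i \<noteq> j \<longrightarrow> \<Lambda> i j > 0) \<and> \<Lambda> i i = 0)"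

text \<open>On \<open>\<p>\<close> the sum is real because \<open>\<Lambda>\<close> is symmetric.\<close>

definition ds2 :: "(nat \<Rightarrow> nat \<Rightarrow> real) \<Rightarrow> 'n::{finite,linorder} cmat \<Rightarrow> 'n cmat \<Rightarrow> real" where
  "ds2 \<Lambda> A B =
     Re (\<Sum>i\<in>UNIV. \<Sum>j\<in>UNIV. of_real (\<Lambda> (pos i) (pos j)) * A $ i $ j * cnj (B $ i $ j))"

definition type_Lambda :: "nat \<Rightarrow> nat \<Rightarrow> (nat \<Rightarrow> nat \<Rightarrow> real) \<Rightarrow> bool" where
  "type_Lambda n k \<Lambda> \<longleftrightarrow> metric_matrix n \<Lambda> \<and>
     (\<forall>i j. 1 \<le> i \<and> i < j \<and> j \<le> n \<and> \<not> (i \<le> k \<and> j = n) \<longrightarrow>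
        \<Lambda> i j = (\<Sum>m\<in>{i..<j}. \<Lambda> m (m + 1))) \<and>
     (\<forall>i. 2 \<le> i \<and> i \<le> k \<longrightarrow> \<Lambda> i n = (\<Sum>m\<in>{1..<i}. \<Lambda> m (m + 1)) + \<Lambda> 1 n)"

definition metrics_M :: "('n::{finite,linorder} cmat \<Rightarrow> 'n cmat \<Rightarrow> real) set" where
  "metrics_M = {ds2 \<Lambda> | \<Lambda> k. 1 \<le> k \<and> k \<le> CARD('n) - 3 \<and> type_Lambda CARD('n) k \<Lambda>}"


section \<open>Maps from a Riemann surface to the flag manifold\<close>

definition chart_overlap ::
  "('m \<Rightarrow> 'n::finite cmat set) \<Rightarrow> 'm chart \<Rightarrow> 'n param \<Rightarrow> 'm set" where
  "chart_overlap \<phi> = (\<lambda>(U, z) (W, s).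
     {p \<in> U. \<phi> p \<in> (\<lambda>x. torus_coset (s x)) ` (W \<inter> tangent_p)})"

definition coord_domain ::
  "('m \<Rightarrow> 'n::finite cmat set) \<Rightarrow> 'm chart \<Rightarrow> 'n param \<Rightarrow> complex set" where
  "coord_domain \<phi> c q = snd c ` chart_overlap \<phi> c q"

definition coord_map ::
  "('m \<Rightarrow> 'n::finite cmat set) \<Rightarrow> 'm chart \<Rightarrow> 'n param \<Rightarrow> complex \<Rightarrow> 'n cmat" where
  "coord_map \<phi> = (\<lambda>(U, z) (W, s) x.
     inv_into (W \<inter> tangent_p) (\<lambda>x. torus_coset (s x)) (\<phi> (inv_into U z x)))"

text \<open>The openness condition is continuity of \<open>\<phi>\<close>: the images of the parametrizations form a base of
  the topology of \<open>F(n)\<close>.\<close>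

definition smooth_to_flag ::
  "'m topology \<Rightarrow> 'm chart set \<Rightarrow> ('m \<Rightarrow> 'n::finite cmat set) \<Rightarrow> bool" where
  "smooth_to_flag X \<A> \<phi> \<longleftrightarrow> \<phi> ` topspace X \<subseteq> flag_manifold \<and>
     (\<forall>c\<in>\<A>. \<forall>q. flag_param q \<longrightarrow>
        openin X (chart_overlap \<phi> c q) \<and> smooth_on (coord_domain \<phi> c q) (coord_map \<phi> c q))"

text \<open>\<open>d\<phi> \<circ> J\<^sub>1 = J\<^sub>2 \<circ> d\<phi>\<close>, where \<open>J\<^sub>1\<close> is multiplication by \<open>\<i>\<close> in holomorphic charts.\<close>

definition holomorphic_to_flag ::
  "'m topology \<Rightarrow> 'm chart set \<Rightarrow> ('n::finite cmat \<Rightarrow> 'n cmat) \<Rightarrow> ('m \<Rightarrow> 'n cmat set) \<Rightarrow> bool" where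
  "holomorphic_to_flag X \<A> J \<phi> \<longleftrightarrow> smooth_to_flag X \<A> \<phi> \<and>
     (\<forall>c\<in>\<A>. \<forall>q. flag_param q \<longrightarrow> (\<forall>x\<in>coord_domain \<phi> c q. \<forall>v.
        Df (coord_map \<phi> c q) x (\<i> * v) =
          invariant_acs J q (coord_map \<phi> c q x) (Df (coord_map \<phi> c q) x v)))"

definition harmonic_to_flag ::
  "'m topology \<Rightarrow> 'm chart set \<Rightarrow> ('m chart \<Rightarrow> complex \<Rightarrow> complex \<Rightarrow> complex \<Rightarrow> real)
     \<Rightarrow> ('n::finite cmat \<Rightarrow> 'n cmat \<Rightarrow> real) \<Rightarrow> ('m \<Rightarrow> 'n cmat set) \<Rightarrow> bool" where
  "harmonic_to_flag X \<A> h g \<phi> \<longleftrightarrow> smooth_to_flag X \<A> \<phi> \<and>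
     (\<forall>c\<in>\<A>. \<forall>q. flag_param q \<longrightarrow> (\<forall>x\<in>coord_domain \<phi> c q.
        tension tangent_p (h c) (invariant_metric g q) (coord_map \<phi> c q) x = 0))"

end

theory Submission
  imports Defs
begin

text \<open>A Hermitian metric on a surface is conformal, so the tension of \<open>\<phi>\<close> in coordinates \<open>u\<close> is a multiple of
  \<open>u\<^sub>x\<^sub>x + u\<^sub>y\<^sub>y + \<Gamma>(u\<^sub>x, u\<^sub>x) + \<Gamma>(u\<^sub>y, u\<^sub>y)\<close>.  Pull the Maurer--Cartan form back by the section \<open>s\<close>: let
  \<open>a\<close>, \<open>b\<close> be its values on \<open>u\<^sub>x\<close>, \<open>u\<^sub>y\<close>, with \<open>\<p>\<close>-components \<open>a'\<close> and \<open>b' = J a'\<close>.  Differentiating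
  \<open>b' = J a'\<close> and using the structure equation gives \<open>\<partial>\<^sub>x a' + \<partial>\<^sub>y b' = J [a, b]'\<close>.  By the Koszul formula the
  tension vanishes if \<open>g(J [a, b]', c') = g(a', [a, c]') + g(b', [b, c]')\<close> for all skew-Hermitian \<open>c\<close>.
  Comparing coefficients, this holds as soon as
  \<open>\<lambda>\<^sub>i\<^sub>l = \<lambda>\<^sub>i\<^sub>j + \<lambda>\<^sub>j\<^sub>l\<close> whenever \<open>i \<rightarrow> j \<rightarrow> l\<close> and \<open>i \<rightarrow> l\<close> in the tournament of \<open>J\<close>, and this is what
  type \<open>\<Lambda>\<^sup>k\<close> says.\<close>

unbundle no Formal_Power_Series.fps_syntax

section \<open>The tournament of an almost complex structure\<close>

lemma pos_inject [simp]: "pos i = pos j \<longleftrightarrow> i = (j :: 'n::{finite,linorder})"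
  by (metis linorder_neq_iff pos_less_iff)

lemma pos_bounds: "1 \<le> pos (i :: 'n::{finite,linorder})" "pos (i :: 'n) \<le> CARD('n)"
  using bij_betw_pos[where 'n = 'n] by (auto simp: bij_betw_def)

text \<open>The adjacency signs of the tournament of \<open>J\<^sub>k\<close>: the value is \<open>1\<close> if \<open>i \<rightarrow> j\<close> and \<open>-1\<close> if \<open>j \<rightarrow> i\<close>.\<close>

definition tournament_sign :: "nat \<Rightarrow> 'n::{finite,linorder} \<Rightarrow> 'n \<Rightarrow> real" where
  "tournament_sign k i j =
     (if i < j then (if pos j = CARD('n) \<and> pos i \<le> k then -1 else 1)
      else if j < i then (if pos i = CARD('n) \<and> pos j \<le> k then 1 else -1) else 0)"

lemma tournament_sign_simps:
  "tournament_sign k i i = 0"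
  "i \<noteq> j \<Longrightarrow> tournament_sign k i j * tournament_sign k i j = 1"
  "tournament_sign k j i = - tournament_sign k i j"
  by (auto simp: tournament_sign_def)

text \<open>The condition on the signs says that \<open>l\<close> beats both \<open>i\<close> and
  \<open>j\<close> or loses to both. Hence the triple is not cyclic, and \<open>\<Lambda>\<close> is
  additive along its directed path of length two. One signed equation covers both cases and both
  directions of the edge between \<open>i\<close> and \<open>j\<close>; this is the form that
  \<open>tournament_sum_identity\<close> needs.\<close>

lemma type_Lambda_transitive:
  fixes i j l :: "'n::{finite,linorder}"
  assumes \<Lambda>: "type_Lambda CARD('n) k \<Lambda>" and k: "k \<le> CARD('n) - 3"
    and ne: "i \<noteq> j" "i \<noteq> l" "j \<noteq> l"
    and e: "tournament_sign k i l \<noteq> tournament_sign k l j"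
  shows "tournament_sign k i l * tournament_sign k i j * \<Lambda> (pos i) (pos j)
           = \<Lambda> (pos i) (pos l) - \<Lambda> (pos l) (pos j)"
proof -
  let ?n = "CARD('n)"
  have sym: "\<Lambda> (pos a) (pos b) = \<Lambda> (pos b) (pos a)" for a b :: 'n
    using \<Lambda> pos_bounds[of a] pos_bounds[of b] by (auto simp: type_Lambda_def metric_matrix_def)
  have add: "\<Lambda> p q = (\<Sum>m\<in>{p..<q}. \<Lambda> m (m + 1))"
    if "1 \<le> p" "p < q" "q \<le> ?n" "\<not> (p \<le> k \<and> q = ?n)" for p q
    using \<Lambda> that unfolding type_Lambda_def by blast
  \<comment> \<open>Triples whose edges all follow the order of the indices. If the edge from
    \<open>a\<close> to \<open>c\<close> is not reversed, neither is the one from \<open>b\<close>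
    to \<open>c\<close>, because \<open>pos a < pos b\<close>.\<close>
  have A: "\<Lambda> (pos a) (pos c) = \<Lambda> (pos a) (pos b) + \<Lambda> (pos b) (pos c)"
    if "a < b" "b < c" "\<not> (pos a \<le> k \<and> pos c = ?n)" for a b c :: 'n
  proof -
    have lt: "pos a < pos b" "pos b < pos c" "pos a < pos c" "1 \<le> pos a" "pos c \<le> ?n"
      using that pos_bounds[of a] pos_bounds[of c] pos_less_iff[of a b] pos_less_iff[of b c] by auto
    then have "\<Lambda> (pos a) (pos c) = (\<Sum>m\<in>{pos a..<pos b}. \<Lambda> m (m + 1)) + (\<Sum>m\<in>{pos b..<pos c}. \<Lambda> m (m + 1))"
      using add[of "pos a" "pos c"] that
        sum.atLeastLessThan_concat[of "pos a" "pos b" "pos c" "\<lambda>m. \<Lambda> m (m + 1)"] by auto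
    also have "\<dots> = \<Lambda> (pos a) (pos b) + \<Lambda> (pos b) (pos c)"
      using add[of "pos a" "pos b"] add[of "pos b" "pos c"] lt that by auto
    finally show ?thesis .
  qed
  \<comment> \<open>The extra clause of the type starts at index 2; for \<open>q = 1\<close> the sum
    is empty.\<close>
  have inn: "\<Lambda> q ?n = (\<Sum>m\<in>{1..<q}. \<Lambda> m (m + 1)) + \<Lambda> 1 ?n" if "1 \<le> q" "q \<le> k" for q
    using \<Lambda> that unfolding type_Lambda_def by (cases "q = 1") auto
  \<comment> \<open>Triples with both edges at the last index reversed: \<open>c\<close> beats
    \<open>a\<close>, \<open>a\<close> beats \<open>b\<close>, and \<open>c\<close> beats
    \<open>b\<close>. The difference of two instances of \<open>inn\<close> is the sum over the
    steps from \<open>a\<close> to \<open>b\<close>.\<close>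
  have B: "\<Lambda> (pos b) (pos c) = \<Lambda> (pos a) (pos b) + \<Lambda> (pos a) (pos c)"
    if "a < b" "pos b \<le> k" "pos c = ?n" for a b c :: 'n
  proof -
    have lt: "pos a < pos b" "1 \<le> pos a" using that pos_bounds[of a] pos_less_iff[of a b] by auto
    have "?n > 0" by simp
    then have "pos b < ?n" using that k by linarith
    then have "\<Lambda> (pos a) (pos b) = (\<Sum>m\<in>{pos a..<pos b}. \<Lambda> m (m + 1))"
      using add[of "pos a" "pos b"] lt by auto
    then show ?thesis
      using inn[of "pos a"] inn[of "pos b"] lt that
        sum.atLeastLessThan_concat[of 1 "pos a" "pos b" "\<lambda>m. \<Lambda> m (m + 1)"] by auto
  qed
  \<comment> \<open>Only edges at the last index can be reversed, and a reversal at \<open>b\<close>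
    forces one at \<open>a\<close>. This leaves three sign patterns, of which the middle one is
    cyclic and carries no relation on \<open>\<Lambda>\<close>.\<close>
  have tri: "tournament_sign k a b = 1 \<and> tournament_sign k b a = -1 \<and>
      tournament_sign k c a = - tournament_sign k a c \<and> tournament_sign k c b = - tournament_sign k b c \<and>
      \<Lambda> (pos b) (pos a) = \<Lambda> (pos a) (pos b) \<and> \<Lambda> (pos c) (pos a) = \<Lambda> (pos a) (pos c) \<and>
      \<Lambda> (pos c) (pos b) = \<Lambda> (pos b) (pos c) \<and>
      (tournament_sign k a c = 1 \<and> tournament_sign k b c = 1 \<and> \<Lambda> (pos a) (pos c) = \<Lambda> (pos a) (pos b) + \<Lambda> (pos b) (pos c) \<or>
       tournament_sign k a c = -1 \<and> tournament_sign k b c = 1 \<or>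
       tournament_sign k a c = -1 \<and> tournament_sign k b c = -1 \<and> \<Lambda> (pos b) (pos c) = \<Lambda> (pos a) (pos b) + \<Lambda> (pos a) (pos c))"
    if "a < b" "b < c" for a b c :: 'n
  proof -
    have "pos a < pos b" "pos b < pos c" "pos c \<le> ?n" "a < c" "\<not> b < a" "\<not> c < b" "\<not> c < a"
      using that pos_bounds[of c] by (auto simp: pos_less_iff)
    then show ?thesis
      using A[OF that] B[OF that(1), of c] that sym[of b a] sym[of c a] sym[of c b]
      by (simp add: tournament_sign_def) blast
  qed
  consider "i < j" "j < l" | "i < l" "l < j" | "j < i" "i < l" | "j < l" "l < i"
    | "l < i" "i < j" | "l < j" "j < i"
    using ne by (meson linorder_neqE)
  then show ?thesis
  proof cases
    case 1 from tri[OF this] e show ?thesis by (elim conjE disjE) simp_all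
  next
    case 2 from tri[OF this] e show ?thesis by (elim conjE disjE) simp_all
  next
    case 3 from tri[OF this] e show ?thesis by (elim conjE disjE) simp_all
  next
    case 4 from tri[OF this] e show ?thesis by (elim conjE disjE) simp_all
  next
    case 5 from tri[OF this] e show ?thesis by (elim conjE disjE) simp_all
  next
    case 6 from tri[OF this] e show ?thesis by (elim conjE disjE) simp_all
  qed
qed

section \<open>The Lie algebra of the unitary group and the entries of its commutators\<close>

definition skew_hermitian :: "'n::finite cmat set" where
  "skew_hermitian = {A. adjoint_mat A = - A}"

definition commutator_mat :: "'n::finite cmat \<Rightarrow> 'n cmat \<Rightarrow> 'n cmat" where
  "commutator_mat A B = A ** B - B ** A"

lemma skew_hermitian_cnj: "A \<in> skew_hermitian \<Longrightarrow> cnj (A $ i $ j) = - A $ j $ i"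
  by (auto simp: skew_hermitian_def adjoint_mat_def vec_eq_iff)

lemma tangent_p_subset_skew: "A \<in> tangent_p \<Longrightarrow> A \<in> skew_hermitian"
  by (auto simp: tangent_p_def skew_hermitian_def)

lemma off_diagonal_in_tangent_p: "A \<in> skew_hermitian \<Longrightarrow> off_diagonal A \<in> tangent_p"
  by (auto simp: tangent_p_def skew_hermitian_def off_diagonal_def adjoint_mat_def vec_eq_iff)

lemma adjoint_mat_mult: "adjoint_mat (A ** B) = adjoint_mat B ** adjoint_mat (A :: 'n::finite cmat)"
  by (simp add: adjoint_mat_def matrix_matrix_mult_def vec_eq_iff mult.commute)

lemma adjoint_mat_simps:
  "adjoint_mat (adjoint_mat A) = A"
  "adjoint_mat (A + B) = adjoint_mat A + adjoint_mat B"
  "adjoint_mat (A - B) = adjoint_mat A - adjoint_mat B"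
  "adjoint_mat (- A) = - adjoint_mat A"
  "adjoint_mat (r *\<^sub>R A) = r *\<^sub>R adjoint_mat A"
  by (auto simp: adjoint_mat_def vec_eq_iff)

lemma matrix_mult_minus:
  "(- A) ** B = - (A ** (B :: 'n::finite cmat))" "A ** (- B) = - (A ** (B :: 'n::finite cmat))"
  by (simp_all add: matrix_matrix_mult_def vec_eq_iff sum_negf)

lemma commutator_mat_skew_hermitian:
  "A \<in> skew_hermitian \<Longrightarrow> B \<in> skew_hermitian \<Longrightarrow> commutator_mat A B \<in> skew_hermitian"
  by (simp add: skew_hermitian_def commutator_mat_def adjoint_mat_simps adjoint_mat_mult matrix_mult_minus)

text \<open>One formula serves both sides of the diagonal: the reflection in \<open>J_flag\<close>
  conjugates \<i> and negates, and the skew symmetry of \<open>A\<close> matches the antisymmetry of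
  the sign.\<close>

lemma J_flag_nth:
  assumes "A \<in> skew_hermitian"
  shows "J_flag k A $ i $ j = \<i> * of_real (tournament_sign k i j) * A $ i $ j"
  using skew_hermitian_cnj[OF assms, of j i]
  by (auto simp: J_flag_def J_upper_def tournament_sign_def)

lemma off_diagonal_nth: "off_diagonal A $ i $ j = (if i = j then 0 else A $ i $ j)"
  by (simp add: off_diagonal_def)

text \<open>The diagonal parts act on the off-diagonal ones by the roots.\<close>

lemma commutator_mat_nth:
  assumes "i \<noteq> j"
  shows "commutator_mat A B $ i $ j =
     (\<Sum>l\<in>UNIV. off_diagonal A $ i $ l * off_diagonal B $ l $ j - off_diagonal B $ i $ l * off_diagonal A $ l $ j)
       + (A $ i $ i - A $ j $ j) * B $ i $ j - (B $ i $ i - B $ j $ j) * A $ i $ j"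
proof -
  have split: "(\<Sum>l\<in>UNIV. X $ i $ l * Y $ l $ j) = (\<Sum>l\<in>UNIV. off_diagonal X $ i $ l * off_diagonal Y $ l $ j)
      + X $ i $ i * Y $ i $ j + X $ i $ j * Y $ j $ j" for X Y :: "'a cmat"
  proof -
    have "(\<Sum>l\<in>UNIV. X $ i $ l * Y $ l $ j) =
       (\<Sum>l\<in>UNIV. off_diagonal X $ i $ l * off_diagonal Y $ l $ j
          + (if l = i then X $ i $ i * Y $ i $ j else 0) + (if l = j then X $ i $ j * Y $ j $ j else 0))"
      using assms by (intro sum.cong) (auto simp: off_diagonal_nth)
    then show ?thesis by (simp add: sum.distrib)
  qed
  have "commutator_mat A B $ i $ j = (\<Sum>l\<in>UNIV. A $ i $ l * B $ l $ j) - (\<Sum>l\<in>UNIV. B $ i $ l * A $ l $ j)"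
    by (simp add: commutator_mat_def matrix_matrix_mult_def)
  then show ?thesis
    unfolding split[of A B] split[of B A] sum_subtractf by (simp add: algebra_simps)
qed

section \<open>The commutator identity for metrics adapted to the tournament\<close>

lemma ds2_altdef:
  "ds2 \<Lambda> A B = (\<Sum>i\<in>UNIV. \<Sum>j\<in>UNIV. \<Lambda> (pos i) (pos j) * Re (A $ i $ j * cnj (B $ i $ j)))"
  by (simp add: ds2_def mult.assoc)

lemma sum_swap_outer:
  "(\<Sum>i\<in>A. \<Sum>j\<in>B. \<Sum>l\<in>A. f l j i) = (\<Sum>i\<in>A. \<Sum>j\<in>B. \<Sum>l\<in>A. (f i j l :: 'b::comm_monoid_add))"
proof -
  have "(\<Sum>i\<in>A. \<Sum>j\<in>B. \<Sum>l\<in>A. f l j i) = (\<Sum>j\<in>B. \<Sum>l\<in>A. \<Sum>i\<in>A. f l j i)"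
    by (subst sum.swap) (intro sum.cong refl sum.swap)
  also have "\<dots> = (\<Sum>l\<in>A. \<Sum>j\<in>B. \<Sum>i\<in>A. f l j i)"
    by (rule sum.swap)
  finally show ?thesis .
qed

text \<open>Both sides are brought to the form \<open>\<Sum> c\<^sub>i\<^sub>j\<^sub>l Re (p\<^sub>i\<^sub>l p\<^sub>l\<^sub>j cnj y\<^sub>i\<^sub>j)\<close>, where the coefficients can be
  compared.  Those of a cyclic triple vanish, those of a transitive triple agree because \<open>L\<close> is
  additive on it.\<close>

lemma tournament_sum_identity:
  fixes L e :: "'n::finite \<Rightarrow> 'n \<Rightarrow> real" and p y :: "'n \<Rightarrow> 'n \<Rightarrow> complex"
  assumes L: "\<And>i j. L i j = L j i" and e: "\<And>i j. e j i = - e i j" "\<And>i j. i \<noteq> j \<Longrightarrow> e i j * e i j = 1"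
    and tri: "\<And>i j l. i \<noteq> j \<Longrightarrow> i \<noteq> l \<Longrightarrow> j \<noteq> l \<Longrightarrow> e i l \<noteq> e l j \<Longrightarrow> e i l * e i j * L i j = L i l - L l j"
    and p: "\<And>i j. cnj (p i j) = - p j i" "\<And>i. p i i = 0" and y: "\<And>i. y i i = 0"
  shows "(\<Sum>i\<in>UNIV. \<Sum>j\<in>UNIV. L i j * Re (\<i> * of_real (e i j)
            * (\<Sum>l\<in>UNIV. p i l * (\<i> * of_real (e l j) * p l j) - \<i> * of_real (e i l) * p i l * p l j) * cnj (y i j)))
       = (\<Sum>i\<in>UNIV. \<Sum>j\<in>UNIV. L i j * Re (p i j * cnj (\<Sum>l\<in>UNIV. p i l * y l j - y i l * p l j)))
       + (\<Sum>i\<in>UNIV. \<Sum>j\<in>UNIV. L i j * Re (\<i> * of_real (e i j) * p i j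
            * cnj (\<Sum>l\<in>UNIV. \<i> * of_real (e i l) * p i l * y l j - y i l * (\<i> * of_real (e l j) * p l j))))"
    (is "?lhs = ?rhs1 + ?rhs2")
proof -
  have R: "Re (of_real r * z) = r * Re z" for r z by simp
  define T where "T i j l = Re (p i l * p l j * cnj (y i j))" for i j l
  \<comment> \<open>The summand 1 comes from the first sum on the right. The product of signs comes
    from the second sum, where \<i> meets its own conjugate.\<close>
  define c1 where "c1 i j l = L i j * (1 + e i j * e i l)" for i j l
  define c2 where "c2 i j l = L i j * (1 + e i j * e l j)" for i j l
  have lhs: "?lhs = (\<Sum>i\<in>UNIV. \<Sum>j\<in>UNIV. \<Sum>l\<in>UNIV. L i j * e i j * (e i l - e l j) * T i j l)"
  proof (intro sum.cong refl)
    fix i j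
    have "L i j * Re (\<i> * of_real (e i j)
            * (\<Sum>l\<in>UNIV. p i l * (\<i> * of_real (e l j) * p l j) - \<i> * of_real (e i l) * p i l * p l j) * cnj (y i j))
       = (\<Sum>l\<in>UNIV. L i j * Re (\<i> * of_real (e i j)
            * (p i l * (\<i> * of_real (e l j) * p l j) - \<i> * of_real (e i l) * p i l * p l j) * cnj (y i j)))"
      by (simp add: sum_distrib_left sum_distrib_right Re_sum del: Re_complex_of_real)
    also have "\<dots> = (\<Sum>l\<in>UNIV. L i j * e i j * (e i l - e l j) * T i j l)"
    proof (intro sum.cong refl)
      fix l
      have "\<i> * of_real (e i j)
            * (p i l * (\<i> * of_real (e l j) * p l j) - \<i> * of_real (e i l) * p i l * p l j) * cnj (y i j)
          = of_real (e i j * (e i l - e l j)) * (p i l * p l j * cnj (y i j))"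
        by (simp add: algebra_simps)
      then have "Re (\<i> * of_real (e i j)
            * (p i l * (\<i> * of_real (e l j) * p l j) - \<i> * of_real (e i l) * p i l * p l j) * cnj (y i j))
          = e i j * (e i l - e l j) * T i j l"
        unfolding T_def by (simp only: R)
      then show "L i j * Re (\<i> * of_real (e i j)
            * (p i l * (\<i> * of_real (e l j) * p l j) - \<i> * of_real (e i l) * p i l * p l j) * cnj (y i j))
          = L i j * e i j * (e i l - e l j) * T i j l"
        by simp
    qed
    finally show "L i j * Re (\<i> * of_real (e i j)
            * (\<Sum>l\<in>UNIV. p i l * (\<i> * of_real (e l j) * p l j) - \<i> * of_real (e i l) * p i l * p l j) * cnj (y i j))
       = (\<Sum>l\<in>UNIV. L i j * e i j * (e i l - e l j) * T i j l)" .
  qed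
  have rhs: "?rhs1 + ?rhs2 = (\<Sum>i\<in>UNIV. \<Sum>j\<in>UNIV. \<Sum>l\<in>UNIV. c2 i j l * T i l j - c1 i j l * T l j i)"
    unfolding sum.distrib[symmetric]
  proof (intro sum.cong refl)
    fix i j
    have "L i j * Re (p i j * cnj (\<Sum>l\<in>UNIV. p i l * y l j - y i l * p l j))
       + L i j * Re (\<i> * of_real (e i j) * p i j
            * cnj (\<Sum>l\<in>UNIV. \<i> * of_real (e i l) * p i l * y l j - y i l * (\<i> * of_real (e l j) * p l j)))
      = (\<Sum>l\<in>UNIV. L i j * Re (p i j * cnj (p i l * y l j - y i l * p l j)
         + \<i> * of_real (e i j) * p i j * cnj (\<i> * of_real (e i l) * p i l * y l j - y i l * (\<i> * of_real (e l j) * p l j))))"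
      unfolding cnj_sum sum_distrib_left Re_sum sum.distrib[symmetric] by (simp add: distrib_left)
    also have "\<dots> = (\<Sum>l\<in>UNIV. c2 i j l * T i l j - c1 i j l * T l j i)"
    proof (intro sum.cong refl)
      fix l
      have "p i j * cnj (p i l * y l j - y i l * p l j)
         + \<i> * of_real (e i j) * p i j * cnj (\<i> * of_real (e i l) * p i l * y l j - y i l * (\<i> * of_real (e l j) * p l j))
        = of_real (1 + e i j * e l j) * (p i j * p j l * cnj (y i l))
           - of_real (1 + e i j * e i l) * (p l i * p i j * cnj (y l j))"
        by (simp add: p(1) algebra_simps)
      then have "Re (p i j * cnj (p i l * y l j - y i l * p l j)
         + \<i> * of_real (e i j) * p i j * cnj (\<i> * of_real (e i l) * p i l * y l j - y i l * (\<i> * of_real (e l j) * p l j)))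
        = (1 + e i j * e l j) * T i l j - (1 + e i j * e i l) * T l j i"
        unfolding T_def by (simp only: minus_complex.sel R)
      then show "L i j * Re (p i j * cnj (p i l * y l j - y i l * p l j)
         + \<i> * of_real (e i j) * p i j * cnj (\<i> * of_real (e i l) * p i l * y l j - y i l * (\<i> * of_real (e l j) * p l j)))
        = c2 i j l * T i l j - c1 i j l * T l j i"
        unfolding c1_def c2_def by (simp only: right_diff_distrib mult.assoc)
    qed
    finally show "L i j * Re (p i j * cnj (\<Sum>l\<in>UNIV. p i l * y l j - y i l * p l j))
       + L i j * Re (\<i> * of_real (e i j) * p i j
            * cnj (\<Sum>l\<in>UNIV. \<i> * of_real (e i l) * p i l * y l j - y i l * (\<i> * of_real (e l j) * p l j)))
       = (\<Sum>l\<in>UNIV. c2 i j l * T i l j - c1 i j l * T l j i)" .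
  qed
  \<comment> \<open>Exchanging \<open>j\<close> with \<open>l\<close> in one sum and
    \<open>i\<close> with \<open>l\<close> in the other turns both into sums over the same
    \<open>T i j l\<close>.\<close>
  have "(\<Sum>i\<in>UNIV. \<Sum>j\<in>UNIV. \<Sum>l\<in>UNIV. c2 i j l * T i l j) = (\<Sum>i\<in>UNIV. \<Sum>j\<in>UNIV. \<Sum>l\<in>UNIV. c2 i l j * T i j l)"
    by (rule sum.cong[OF refl sum.swap])
  moreover have "(\<Sum>i\<in>UNIV. \<Sum>j\<in>UNIV. \<Sum>l\<in>UNIV. c1 i j l * T l j i) = (\<Sum>i\<in>UNIV. \<Sum>j\<in>UNIV. \<Sum>l\<in>UNIV. c1 l j i * T i j l)"
    by (rule sum_swap_outer)
  ultimately have "?rhs1 + ?rhs2 = (\<Sum>i\<in>UNIV. \<Sum>j\<in>UNIV. \<Sum>l\<in>UNIV. (c2 i l j - c1 l j i) * T i j l)"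
    unfolding rhs by (simp only: sum_subtractf left_diff_distrib)
  also have "\<dots> = ?lhs"
    unfolding lhs
  proof (intro sum.cong refl)
    fix i j l
    show "(c2 i l j - c1 l j i) * T i j l = L i j * e i j * (e i l - e l j) * T i j l"
    \<comment> \<open>Coinciding indices put a diagonal entry of \<open>p\<close> or
      \<open>y\<close> into \<open>T i j l\<close>, which is then zero.\<close>
    proof (cases "i = j \<or> i = l \<or> j = l")
      case True
      then have "T i j l = 0" using p(2) y by (auto simp: T_def)
      then show ?thesis by simp
    next
      case False
      have c: "c2 i l j - c1 l j i = (L i l - L l j) * (1 - e i l * e l j)"
        using e(1)[of j l] e(1)[of l i] by (simp add: c1_def c2_def algebra_simps)
      have sq: "e i l * e i l = 1" "e l j * e l j = 1" using e(2) False by auto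
      \<comment> \<open>If the two signs agree, their product is 1 and both coefficients vanish.
        Otherwise the product is -1, and \<open>tri\<close> turns the difference of weights into a
        signed \<open>L i j\<close>, with the factor 2 on both sides.\<close>
      show ?thesis
      proof (cases "e i l = e l j")
        case True
        then show ?thesis using sq by (simp add: c)
      next
        case ne: False
        then have el: "e l j = - e i l" using sq by (metis square_eq_iff)
        have tr: "L i l - L l j = e i l * e i j * L i j" using tri[of i j l] False ne by simp
        show ?thesis unfolding c tr el using sq(1) by (simp add: algebra_simps)
      qed
    qed
  qed
  finally show ?thesis ..
qed

text \<open>The diagonal entries of the three matrices enter only through the root terms of
  \<open>commutator_mat_nth\<close>. The terms with the diagonals of \<open>A\<close> and
  \<open>B\<close> cancel entry by entry, those with the diagonal of \<open>C\<close> have real part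
  zero, and the remainder is \<open>tournament_sum_identity\<close>.\<close>

lemma ds2_J_flag_commutator:
  fixes A B C :: "'n::{finite,linorder} cmat"
  assumes \<Lambda>: "type_Lambda CARD('n) k \<Lambda>" and k: "k \<le> CARD('n) - 3"
    and A: "A \<in> skew_hermitian" and B: "B \<in> skew_hermitian" and C: "C \<in> skew_hermitian"
    and JB: "off_diagonal B = J_flag k (off_diagonal A)"
  shows "ds2 \<Lambda> (J_flag k (off_diagonal (commutator_mat A B))) (off_diagonal C)
    = ds2 \<Lambda> (off_diagonal A) (off_diagonal (commutator_mat A C))
      + ds2 \<Lambda> (off_diagonal B) (off_diagonal (commutator_mat B C))"
proof -
  define L where "L i j = \<Lambda> (pos i) (pos j)" for i j :: 'n
  define e where "e i j = tournament_sign k i j" for i j :: 'n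
  define p where "p i j = off_diagonal A $ i $ j" for i j
  define y where "y i j = off_diagonal C $ i $ j" for i j
  have Lsym: "L i j = L j i" and L0: "L i i = 0" for i j
    using \<Lambda> pos_bounds[of i] pos_bounds[of j] by (auto simp: L_def type_Lambda_def metric_matrix_def)
  have oA: "off_diagonal A \<in> skew_hermitian"
    using A by (simp add: off_diagonal_in_tangent_p tangent_p_subset_skew)
  have q: "off_diagonal B $ i $ j = \<i> * of_real (e i j) * p i j" for i j
    unfolding JB J_flag_nth[OF oA] by (simp add: e_def p_def)
  have psk: "cnj (p i j) = - p j i" for i j
    using skew_hermitian_cnj[OF oA] by (simp add: p_def)
  have p0: "p i i = 0" "y i i = 0" for i by (simp_all add: p_def y_def off_diagonal_nth)
  have diagA: "cnj (A $ i $ i) = - A $ i $ i" and diagB: "cnj (B $ i $ i) = - B $ i $ i"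
    and diagC: "cnj (C $ i $ i) = - C $ i $ i" for i
    using A B C by (simp_all add: skew_hermitian_cnj)
  define S1 S2 S3 where
    "S1 i j = (\<Sum>l\<in>UNIV. p i l * (\<i> * of_real (e l j) * p l j) - \<i> * of_real (e i l) * p i l * p l j)" and
    "S2 i j = (\<Sum>l\<in>UNIV. p i l * y l j - y i l * p l j)" and
    "S3 i j = (\<Sum>l\<in>UNIV. \<i> * of_real (e i l) * p i l * y l j - y i l * (\<i> * of_real (e l j) * p l j))" for i j
  have nth: "commutator_mat A B $ i $ j = S1 i j + (A $ i $ i - A $ j $ j) * (\<i> * of_real (e i j) * p i j) - (B $ i $ i - B $ j $ j) * p i j"
    "commutator_mat A C $ i $ j = S2 i j + (A $ i $ i - A $ j $ j) * y i j - (C $ i $ i - C $ j $ j) * p i j"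
    "commutator_mat B C $ i $ j = S3 i j + (B $ i $ i - B $ j $ j) * y i j - (C $ i $ i - C $ j $ j) * (\<i> * of_real (e i j) * p i j)"
    if "i \<noteq> j" for i j
  proof -
    have off: "p i j = A $ i $ j" "y i j = C $ i $ j" "B $ i $ j = \<i> * of_real (e i j) * p i j"
      using that q[of i j] by (simp_all add: p_def y_def off_diagonal_nth)
    show "commutator_mat A B $ i $ j = S1 i j + (A $ i $ i - A $ j $ j) * (\<i> * of_real (e i j) * p i j) - (B $ i $ i - B $ j $ j) * p i j"
      unfolding commutator_mat_nth[OF that] S1_def q off(3) p_def[symmetric] off(1)[symmetric] by simp
    show "commutator_mat A C $ i $ j = S2 i j + (A $ i $ i - A $ j $ j) * y i j - (C $ i $ i - C $ j $ j) * p i j"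
      unfolding commutator_mat_nth[OF that] S2_def p_def[symmetric] y_def[symmetric] off by simp
    show "commutator_mat B C $ i $ j = S3 i j + (B $ i $ i - B $ j $ j) * y i j - (C $ i $ i - C $ j $ j) * (\<i> * of_real (e i j) * p i j)"
      unfolding commutator_mat_nth[OF that] S3_def q off(3) y_def[symmetric] off(2)[symmetric] by simp
  qed
  have oAB: "off_diagonal (commutator_mat A B) \<in> skew_hermitian"
    using A B by (simp add: off_diagonal_in_tangent_p tangent_p_subset_skew commutator_mat_skew_hermitian)
  have ptw: "L i j * Re (J_flag k (off_diagonal (commutator_mat A B)) $ i $ j * cnj (y i j))
      - L i j * Re (p i j * cnj (off_diagonal (commutator_mat A C) $ i $ j))
      - L i j * Re (off_diagonal B $ i $ j * cnj (off_diagonal (commutator_mat B C) $ i $ j))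
     = L i j * Re (\<i> * of_real (e i j) * S1 i j * cnj (y i j))
      - L i j * Re (p i j * cnj (S2 i j)) - L i j * Re (\<i> * of_real (e i j) * p i j * cnj (S3 i j))" for i j
  proof (cases "i = j")
    case True then show ?thesis by (simp add: L0)
  next
    case False
    have ee: "of_real (e i j) * of_real (e i j) = (1::complex)"
      unfolding of_real_mult[symmetric] using tournament_sign_simps(2)[OF False, of k] by (simp add: e_def)
    define \<alpha> \<beta> \<gamma> where "\<alpha> = A $ i $ i - A $ j $ j" and "\<beta> = B $ i $ i - B $ j $ j" and "\<gamma> = C $ i $ i - C $ j $ j"
    have cn: "cnj \<alpha> = - \<alpha>" "cnj \<beta> = - \<beta>" "cnj \<gamma> = - \<gamma>"
      by (simp_all add: \<alpha>_def \<beta>_def \<gamma>_def diagA diagB diagC)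
    have "J_flag k (off_diagonal (commutator_mat A B)) $ i $ j * cnj (y i j)
        - p i j * cnj (off_diagonal (commutator_mat A C) $ i $ j)
        - off_diagonal B $ i $ j * cnj (off_diagonal (commutator_mat B C) $ i $ j)
      = \<i> * of_real (e i j) * S1 i j * cnj (y i j) - p i j * cnj (S2 i j) - \<i> * of_real (e i j) * p i j * cnj (S3 i j)
        - 2 * \<gamma> * (p i j * cnj (p i j))"
      unfolding J_flag_nth[OF oAB] q using False
      by (simp add: off_diagonal_nth nth e_def[symmetric] \<alpha>_def[symmetric] \<beta>_def[symmetric] \<gamma>_def[symmetric]
          cn algebra_simps ee)
    \<comment> \<open>A difference of diagonal entries of a skew-Hermitian matrix is imaginary, and
      here it multiplies a squared modulus.\<close>
    moreover have "Re (2 * \<gamma> * (p i j * cnj (p i j))) = 0"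
    proof -
      have "Re \<gamma> = 0" using arg_cong[OF cn(3), of Re] by simp
      then show ?thesis by (simp add: complex_mult_cnj)
    qed
    ultimately have "Re (J_flag k (off_diagonal (commutator_mat A B)) $ i $ j * cnj (y i j))
        - Re (p i j * cnj (off_diagonal (commutator_mat A C) $ i $ j))
        - Re (off_diagonal B $ i $ j * cnj (off_diagonal (commutator_mat B C) $ i $ j))
      = Re (\<i> * of_real (e i j) * S1 i j * cnj (y i j)) - Re (p i j * cnj (S2 i j))
        - Re (\<i> * of_real (e i j) * p i j * cnj (S3 i j))"
      by (metis (no_types, lifting) minus_complex.sel(1) diff_zero)
    then show ?thesis by (simp only: right_diff_distrib[symmetric])
  qed
  have "(\<Sum>i\<in>UNIV. \<Sum>j\<in>UNIV. L i j * Re (\<i> * of_real (e i j) * S1 i j * cnj (y i j)))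
    = (\<Sum>i\<in>UNIV. \<Sum>j\<in>UNIV. L i j * Re (p i j * cnj (S2 i j)))
      + (\<Sum>i\<in>UNIV. \<Sum>j\<in>UNIV. L i j * Re (\<i> * of_real (e i j) * p i j * cnj (S3 i j)))"
    unfolding S1_def S2_def S3_def
  proof (rule tournament_sum_identity)
    show "e i l * e i j * L i j = L i l - L l j" if "i \<noteq> j" "i \<noteq> l" "j \<noteq> l" "e i l \<noteq> e l j" for i j l
      using type_Lambda_transitive[OF \<Lambda> k that(1-3)] that(4) by (simp add: e_def L_def)
  qed (use Lsym psk p0 tournament_sign_simps in \<open>auto simp: e_def\<close>)
  then have "(\<Sum>i\<in>UNIV. \<Sum>j\<in>UNIV. L i j * Re (\<i> * of_real (e i j) * S1 i j * cnj (y i j))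
      - L i j * Re (p i j * cnj (S2 i j)) - L i j * Re (\<i> * of_real (e i j) * p i j * cnj (S3 i j))) = 0"
    by (simp add: sum_subtractf)
  then have "(\<Sum>i\<in>UNIV. \<Sum>j\<in>UNIV. L i j * Re (J_flag k (off_diagonal (commutator_mat A B)) $ i $ j * cnj (y i j))
      - L i j * Re (p i j * cnj (off_diagonal (commutator_mat A C) $ i $ j))
      - L i j * Re (off_diagonal B $ i $ j * cnj (off_diagonal (commutator_mat B C) $ i $ j))) = 0"
    unfolding ptw .
  then show ?thesis
    unfolding ds2_altdef L_def[symmetric] p_def[symmetric] y_def[symmetric] by (simp add: sum_subtractf)
qed

section \<open>Second derivatives\<close>

lemma smooth_on_differentiable: "smooth_on S f \<Longrightarrow> x \<in> S \<Longrightarrow> f differentiable (at x)"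
  using Ck_on.simps(2)[of 0 f S] by (auto simp: smooth_on_def)

lemma smooth_on_Df: "smooth_on S f \<Longrightarrow> smooth_on S (\<lambda>x. Df f x v)"
  unfolding smooth_on_def using Ck_on.simps(2) by blast

lemma smooth_on_continuous: "smooth_on S f \<Longrightarrow> continuous_on S f"
  unfolding smooth_on_def by (metis Ck_on.simps(1))

lemma Df_inner_left:
  assumes "f differentiable (at x)"
  shows "Df (\<lambda>p. f p \<bullet> b) x v = Df f x v \<bullet> b"
proof -
  have "((\<lambda>p. f p \<bullet> b) has_derivative (\<lambda>v. Df f x v \<bullet> b)) (at x)"
    using assms by (intro has_derivative_inner_left) (simp add: frechet_derivative_works)
  then show ?thesis by (metis frechet_derivative_at)
qed

text \<open>The mean value theorem is applied first along \<open>v\<close> and then along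
  \<open>w\<close>. The bound on \<open>t\<close> keeps the whole parallelogram inside the
  ball.\<close>

lemma second_difference_mvt:
  fixes f :: "'a::euclidean_space \<Rightarrow> real"
  assumes f: "smooth_on S f" and x: "ball x r \<subseteq> S" and t: "0 < t" "t * (norm v + norm w) < r"
  obtains p where "p \<in> ball x r"
    "f (x + t *\<^sub>R v + t *\<^sub>R w) - f (x + t *\<^sub>R v) - f (x + t *\<^sub>R w) + f x
       = t\<^sup>2 * Df (\<lambda>p. Df f p v) p w"
proof -
  have inb: "x + a *\<^sub>R v + b *\<^sub>R w \<in> ball x r" if "0 \<le> a" "a \<le> t" "0 \<le> b" "b \<le> t" for a b
  proof -
    have "norm (a *\<^sub>R v + b *\<^sub>R w) \<le> a * norm v + b * norm w"
      using that norm_triangle_ineq[of "a *\<^sub>R v" "b *\<^sub>R w"] by simp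
    also have "\<dots> \<le> t * norm v + t * norm w"
      using that by (intro add_mono mult_right_mono) auto
    finally have "norm (a *\<^sub>R v + b *\<^sub>R w) < r" using t by (simp add: distrib_left)
    then show ?thesis by (simp add: dist_norm norm_minus_commute algebra_simps)
  qed
  have der: "((\<lambda>\<rho>. g (c + \<rho> *\<^sub>R d)) has_derivative (\<lambda>h. h * Df g (c + \<rho> *\<^sub>R d) d)) (at \<rho>)"
    if "g differentiable (at (c + \<rho> *\<^sub>R d))" for g :: "'a \<Rightarrow> real" and c d \<rho>
  proof -
    have "(g has_derivative Df g (c + \<rho> *\<^sub>R d)) (at (c + \<rho> *\<^sub>R d))"
      using that by (simp add: frechet_derivative_works)
    moreover have "((\<lambda>\<rho>. c + \<rho> *\<^sub>R d) has_derivative (\<lambda>h. h *\<^sub>R d)) (at \<rho>)"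
      by (auto intro!: derivative_eq_intros)
    ultimately have "((\<lambda>\<rho>. g (c + \<rho> *\<^sub>R d)) has_derivative (\<lambda>h. Df g (c + \<rho> *\<^sub>R d) (h *\<^sub>R d))) (at \<rho>)"
      by (rule has_derivative_compose[rotated])
    then show ?thesis
      using linear_frechet_derivative[OF that] by (simp add: linear_cmul)
  qed
  \<comment> \<open>The increment along \<open>w\<close> as a function of the step along
    \<open>v\<close>; its own increment is the second difference.\<close>
  define F where "F \<rho> = f (x + t *\<^sub>R w + \<rho> *\<^sub>R v) - f (x + \<rho> *\<^sub>R v)" for \<rho>
  have inS: "x + a *\<^sub>R v + b *\<^sub>R w \<in> S" if "0 \<le> a" "a \<le> t" "0 \<le> b" "b \<le> t" for a b
    using inb[OF that] x by auto
  have dF: "(F has_derivative (\<lambda>h. h * (Df f (x + t *\<^sub>R w + \<rho> *\<^sub>R v) v - Df f (x + \<rho> *\<^sub>R v) v))) (at \<rho>)"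
    if "0 \<le> \<rho>" "\<rho> \<le> t" for \<rho>
  proof -
    have "x + t *\<^sub>R w + \<rho> *\<^sub>R v \<in> S" "x + \<rho> *\<^sub>R v \<in> S"
      using inS[of \<rho> t] inS[of \<rho> 0] that t by (simp_all add: add_ac)
    then show ?thesis
      unfolding F_def right_diff_distrib
      by (intro has_derivative_diff der smooth_on_differentiable[OF f])
  qed
  obtain \<xi> where \<xi>: "0 < \<xi>" "\<xi> < t"
      "F t - F 0 = t * (Df f (x + t *\<^sub>R w + \<xi> *\<^sub>R v) v - Df f (x + \<xi> *\<^sub>R v) v)"
    using mvt_simple[OF t(1), of F "\<lambda>\<rho> h. h * (Df f (x + t *\<^sub>R w + \<rho> *\<^sub>R v) v - Df f (x + \<rho> *\<^sub>R v) v)"]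
    using has_derivative_at_withinI[OF dF] by auto
  define G where "G \<rho> = Df f (x + \<xi> *\<^sub>R v + \<rho> *\<^sub>R w) v" for \<rho>
  have dG: "(G has_derivative (\<lambda>h. h * Df (\<lambda>p. Df f p v) (x + \<xi> *\<^sub>R v + \<rho> *\<^sub>R w) w)) (at \<rho>)"
    if "0 \<le> \<rho>" "\<rho> \<le> t" for \<rho>
    unfolding G_def using inS[of \<xi> \<rho>] that \<xi>
    by (intro der[of "\<lambda>p. Df f p v"] smooth_on_differentiable[OF smooth_on_Df[OF f]]) auto
  obtain \<eta> where \<eta>: "0 < \<eta>" "\<eta> < t"
      "G t - G 0 = t * Df (\<lambda>p. Df f p v) (x + \<xi> *\<^sub>R v + \<eta> *\<^sub>R w) w"
    using mvt_simple[OF t(1), of G "\<lambda>\<rho> h. h * Df (\<lambda>p. Df f p v) (x + \<xi> *\<^sub>R v + \<rho> *\<^sub>R w) w"]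
    using has_derivative_at_withinI[OF dG] by auto
  have "f (x + t *\<^sub>R v + t *\<^sub>R w) - f (x + t *\<^sub>R v) - f (x + t *\<^sub>R w) + f x = F t - F 0"
    by (simp add: F_def add_ac)
  also have "\<dots> = t * (G t - G 0)"
    unfolding \<xi>(3) G_def by (simp add: add_ac)
  also have "\<dots> = t\<^sup>2 * Df (\<lambda>p. Df f p v) (x + \<xi> *\<^sub>R v + \<eta> *\<^sub>R w) w"
    unfolding \<eta>(3) by (simp add: power2_eq_square)
  finally show ?thesis
    using inb[of \<xi> \<eta>] \<xi> \<eta> by (intro that) auto
qed

text \<open>The second difference is symmetric in \<open>v\<close> and \<open>w\<close>, so the two
  mixed derivatives take a common value, though at different points, inside every ball around
  \<open>x\<close>. Continuity of both at \<open>x\<close> does the rest.\<close>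

lemma symmetric_second_derivative_real:
  fixes f :: "'a::euclidean_space \<Rightarrow> real"
  assumes S: "open S" and f: "smooth_on S f" and x: "x \<in> S"
  shows "Df (\<lambda>p. Df f p v) x w = Df (\<lambda>p. Df f p w) x v"
proof (rule ccontr)
  define g1 where "g1 p = Df (\<lambda>p. Df f p v) p w" for p
  define g2 where "g2 p = Df (\<lambda>p. Df f p w) p v" for p
  assume "\<not> ?thesis"
  then have ne: "g1 x \<noteq> g2 x" by (simp add: g1_def g2_def)
  \<comment> \<open>Half of the supposed gap: two errors smaller than this cannot bridge it.\<close>
  define \<epsilon> where "\<epsilon> = \<bar>g1 x - g2 x\<bar> / 2"
  have \<epsilon>: "\<epsilon> > 0" using ne by (simp add: \<epsilon>_def)
  have "isCont g1 x" "isCont g2 x"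
    using smooth_on_continuous[OF smooth_on_Df[OF smooth_on_Df[OF f]]] S x
    unfolding g1_def g2_def by (auto simp: continuous_on_eq_continuous_at)
  then have "\<forall>\<^sub>F p in nhds x. dist (g1 p) (g1 x) < \<epsilon> \<and> dist (g2 p) (g2 x) < \<epsilon> \<and> p \<in> S"
    using \<epsilon> S x by (intro eventually_conj)
      (auto simp: continuous_at isCont_def tendsto_iff eventually_nhds_conv_at eventually_at_topological eventually_nhds)
  then obtain r where r: "r > 0"
    "\<And>p. dist p x < r \<Longrightarrow> dist (g1 p) (g1 x) < \<epsilon> \<and> dist (g2 p) (g2 x) < \<epsilon> \<and> p \<in> S"
    by (auto simp: eventually_nhds_metric)
  have ball: "ball x r \<subseteq> S" using r by (auto simp: dist_commute)
  \<comment> \<open>The summand 1 keeps the denominator positive when \<open>v\<close> and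
    \<open>w\<close> vanish and makes the bound strict.\<close>
  define t where "t = r / (norm v + norm w + 1)"
  have pos: "norm v + norm w + 1 > 0" using norm_ge_zero[of v] norm_ge_zero[of w] by linarith
  then have t: "t > 0" "t * (norm v + norm w) < r"
    using r(1) by (auto simp: t_def field_simps)
  obtain p where p: "p \<in> ball x r"
      "f (x + t *\<^sub>R v + t *\<^sub>R w) - f (x + t *\<^sub>R v) - f (x + t *\<^sub>R w) + f x = t\<^sup>2 * g1 p"
    using second_difference_mvt[OF f ball t] unfolding g1_def by blast
  obtain q where q: "q \<in> ball x r"
      "f (x + t *\<^sub>R w + t *\<^sub>R v) - f (x + t *\<^sub>R w) - f (x + t *\<^sub>R v) + f x = t\<^sup>2 * g2 q"
    using second_difference_mvt[OF f ball t(1), of w v] t unfolding g2_def by (metis add.commute)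
  have c: "x + t *\<^sub>R w + t *\<^sub>R v = x + t *\<^sub>R v + t *\<^sub>R w" by (simp add: add_ac)
  have "t\<^sup>2 * g1 p = t\<^sup>2 * g2 q"
    using p(2) q(2) unfolding c by linarith
  then have "g1 p = g2 q" using t by simp
  moreover have "dist (g1 p) (g1 x) < \<epsilon>" "dist (g2 q) (g2 x) < \<epsilon>"
    using p q r(2) by (auto simp: dist_commute)
  ultimately have "\<bar>g1 x - g2 x\<bar> < \<epsilon> + \<epsilon>" unfolding dist_real_def by linarith
  then show False by (simp add: \<epsilon>_def)
qed

text \<open>Induction on the order of differentiability. The derivative of the inner product is
  known on \<open>S\<close> only, so the step needs that \<open>Ck_on\<close> over an open set
  depends only on the values there.\<close>

lemma smooth_on_inner_left:
  assumes S: "open S"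
  shows "smooth_on S f \<Longrightarrow> smooth_on S (\<lambda>x. f x \<bullet> b)"
proof -
  have "Ck_on r f S \<Longrightarrow> Ck_on r (\<lambda>x. f x \<bullet> b) S" for r and f :: "'a \<Rightarrow> 'b"
  proof (induction r arbitrary: f)
    case 0
    then show ?case by (auto intro!: continuous_intros)
  next
    case (Suc r)
    have cong: "Ck_on r g S \<longleftrightarrow> Ck_on r h S" if "\<And>x. x \<in> S \<Longrightarrow> g x = h x" for g h :: "'a \<Rightarrow> real" and r
      using that
    proof (induction r arbitrary: g h)
      case 0
      then show ?case by (auto cong: continuous_on_cong)
    next
      case (Suc r)
      have *: "(g differentiable (at x)) = (h differentiable (at x)) \<and> Df g x = Df h x" if "x \<in> S" for x
      proof -
        have "(g has_derivative D) (at x) \<longleftrightarrow> (h has_derivative D) (at x)" for D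
          using has_derivative_transform_within_open[OF _ S that] Suc.prems by metis
        then show ?thesis by (simp add: differentiable_def frechet_derivative_def)
      qed
      then have "Ck_on r (\<lambda>x. Df g x v) S \<longleftrightarrow> Ck_on r (\<lambda>x. Df h x v) S" for v
        by (intro Suc.IH) auto
      with * show ?case by auto
    qed
    have "Ck_on r (\<lambda>x. Df f x v \<bullet> b) S" for v
      using Suc by simp
    then have "Ck_on r (\<lambda>x. Df (\<lambda>p. f p \<bullet> b) x v) S" for v
      using Suc.prems by (subst cong[of _ "\<lambda>x. Df f x v \<bullet> b"]) (auto simp: Df_inner_left)
    moreover have "(\<lambda>x. f x \<bullet> b) differentiable (at x)" if "x \<in> S" for x
      using Suc.prems that by (auto intro!: differentiable_inner)
    ultimately show ?case by simp
  qed
  then show "smooth_on S f \<Longrightarrow> smooth_on S (\<lambda>x. f x \<bullet> b)"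
    by (auto simp: smooth_on_def)
qed

lemma symmetric_second_derivative:
  fixes f :: "'a::euclidean_space \<Rightarrow> 'b::euclidean_space"
  assumes S: "open S" and f: "smooth_on S f" and x: "x \<in> S"
  shows "Df (\<lambda>p. Df f p v) x w = Df (\<lambda>p. Df f p w) x v"
proof (rule euclidean_eqI)
  fix b :: 'b
  have *: "Df (\<lambda>p. Df f p v) x w \<bullet> b = Df (\<lambda>p. Df (\<lambda>q. f q \<bullet> b) p v) x w" for v w
  proof -
    have "Df (\<lambda>p. Df f p v) x w \<bullet> b = Df (\<lambda>p. Df f p v \<bullet> b) x w"
      using smooth_on_differentiable[OF smooth_on_Df[OF f] x] by (simp add: Df_inner_left)
    also have "Df (\<lambda>p. Df f p v \<bullet> b) x = Df (\<lambda>p. Df (\<lambda>q. f q \<bullet> b) p v) x"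
    proof (rule frechet_derivative_transform_within_open[OF _ S x])
      show "(\<lambda>p. Df f p v \<bullet> b) differentiable (at x)"
        using smooth_on_differentiable[OF smooth_on_Df[OF f] x] by (auto intro!: differentiable_inner)
    qed (simp add: Df_inner_left smooth_on_differentiable[OF f])
    finally show ?thesis .
  qed
  show "Df (\<lambda>p. Df f p v) x w \<bullet> b = Df (\<lambda>p. Df f p w) x v \<bullet> b"
    unfolding * by (rule symmetric_second_derivative_real[OF S smooth_on_inner_left[OF S f] x])
qed

text \<open>A product rule for a linear map that varies with the base point. Expanding in a basis
  reduces it to finitely many products; it serves to differentiate frame components along a
  map.\<close>

lemma has_derivative_linear_family:
  fixes L :: "'b::euclidean_space \<Rightarrow> 'c::euclidean_space \<Rightarrow> 'd::real_normed_vector"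
    and u :: "'a::real_normed_vector \<Rightarrow> 'b"
  assumes S: "open S" "u x \<in> S" and lin: "\<And>p. p \<in> S \<Longrightarrow> linear (L p)"
    and diff: "\<And>v. (\<lambda>p. L p v) differentiable (at (u x))"
    and u: "(u has_derivative u') (at x)" and c: "(c has_derivative c') (at x)"
  shows "((\<lambda>x. L (u x) (c x)) has_derivative (\<lambda>d. Df (\<lambda>p. L p (c x)) (u x) (u' d) + L (u x) (c' d))) (at x)"
proof -
  have expand: "L p v = (\<Sum>b\<in>Basis. (v \<bullet> b) *\<^sub>R L p b)" if "p \<in> S" for p v
  proof -
    have "L p v = L p (\<Sum>b\<in>Basis. (v \<bullet> b) *\<^sub>R b)" by (simp add: euclidean_representation)
    also have "\<dots> = (\<Sum>b\<in>Basis. (v \<bullet> b) *\<^sub>R L p b)"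
      using lin[OF that] by (simp add: linear_sum linear_cmul)
    finally show ?thesis .
  qed
  have dL: "((\<lambda>p. L p v) has_derivative Df (\<lambda>p. L p v) (u x)) (at (u x))" for v
    using diff by (simp add: frechet_derivative_works)
  have "((\<lambda>p. \<Sum>b\<in>Basis. (c x \<bullet> b) *\<^sub>R L p b) has_derivative
      (\<lambda>d. \<Sum>b\<in>Basis. (c x \<bullet> b) *\<^sub>R Df (\<lambda>p. L p b) (u x) d)) (at (u x))"
    by (intro has_derivative_sum has_derivative_scaleR_right dL)
  then have "((\<lambda>p. L p (c x)) has_derivative
      (\<lambda>d. \<Sum>b\<in>Basis. (c x \<bullet> b) *\<^sub>R Df (\<lambda>p. L p b) (u x) d)) (at (u x))"
    by (rule has_derivative_transform_within_open[OF _ S]) (simp add: expand[symmetric])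
  then have D: "Df (\<lambda>p. L p (c x)) (u x) = (\<lambda>d. \<Sum>b\<in>Basis. (c x \<bullet> b) *\<^sub>R Df (\<lambda>p. L p b) (u x) d)"
    by (metis frechet_derivative_at)
  have "((\<lambda>x. \<Sum>b\<in>Basis. (c x \<bullet> b) *\<^sub>R L (u x) b) has_derivative
      (\<lambda>d. \<Sum>b\<in>Basis. (c x \<bullet> b) *\<^sub>R Df (\<lambda>p. L p b) (u x) (u' d) + (c' d \<bullet> b) *\<^sub>R L (u x) b)) (at x)"
    by (intro has_derivative_sum has_derivative_scaleR has_derivative_inner_left c
        has_derivative_compose[OF u dL])
  \<comment> \<open>The maps \<open>L p\<close> are linear only for \<open>p\<close> in
    \<open>S\<close>, so the expansion holds only near \<open>x\<close>, where continuity keeps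
    \<open>u\<close> inside \<open>S\<close>.\<close>
  moreover obtain T where "open T" "x \<in> T" "\<And>y. y \<in> T \<Longrightarrow> (\<Sum>b\<in>Basis. (c y \<bullet> b) *\<^sub>R L (u y) b) = L (u y) (c y)"
  proof -
    have "\<forall>\<^sub>F y in nhds x. L (u y) (c y) = (\<Sum>b\<in>Basis. (c y \<bullet> b) *\<^sub>R L (u y) b)"
    proof -
      have "isCont u x" using u by (rule has_derivative_continuous)
      then have "(u \<longlongrightarrow> u x) (nhds x)"
        by (simp add: isCont_def tendsto_at_iff_tendsto_nhds)
      then have "\<forall>\<^sub>F y in nhds x. u y \<in> S"
        using S by (rule topological_tendstoD)
      then show ?thesis by eventually_elim (rule expand)
    qed
    then show ?thesis using that by (auto simp: eventually_nhds)
  qed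
  ultimately have "((\<lambda>x. L (u x) (c x)) has_derivative
      (\<lambda>d. \<Sum>b\<in>Basis. (c x \<bullet> b) *\<^sub>R Df (\<lambda>p. L p b) (u x) (u' d) + (c' d \<bullet> b) *\<^sub>R L (u x) b)) (at x)"
    by (rule has_derivative_transform_within_open)
  also have "(\<lambda>d. \<Sum>b\<in>Basis. (c x \<bullet> b) *\<^sub>R Df (\<lambda>p. L p b) (u x) (u' d) + (c' d \<bullet> b) *\<^sub>R L (u x) b)
     = (\<lambda>d. Df (\<lambda>p. L p (c x)) (u x) (u' d) + L (u x) (c' d))"
    unfolding D expand[OF S(2), of "c' _"] by (simp add: sum.distrib)
  finally show ?thesis .
qed

section \<open>Christoffel symbols\<close>

lemma frechet_derivative_eqI: "(f has_derivative f') (at x) \<Longrightarrow> Df f x v = f' v"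
  using frechet_derivative_at by metis

text \<open>Sending \<open>c\<close> to the vector with coefficients \<open>B c b\<close> in an
  orthonormal basis of \<open>E\<close> is a linear map from \<open>E\<close> to \<open>E\<close>.
  It is injective, hence onto by dimension. This makes the definite description in
  \<open>christoffel\<close> meaningful.\<close>

lemma subspace_riesz_representation:
  fixes B :: "'a::euclidean_space \<Rightarrow> 'a \<Rightarrow> real"
  assumes E: "subspace E" and B: "bilinear B" and nz: "\<And>c. c \<in> E \<Longrightarrow> B c c = 0 \<Longrightarrow> c = 0"
    and f: "linear f"
  shows "\<exists>!c. c \<in> E \<and> (\<forall>y\<in>E. B c y = f y)"
proof -
  obtain N where N: "N \<subseteq> E" "pairwise orthogonal N" "\<And>x. x \<in> N \<Longrightarrow> norm x = 1"
    "independent N" "card N = dim E" "span N = E"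
    using orthonormal_basis_subspace[OF E] by metis
  have fin: "finite N" using N(4) by (simp add: independent_imp_finite)
  define T where "T c = (\<Sum>b\<in>N. B c b *\<^sub>R b)" for c
  have linB: "linear (\<lambda>c. B c b)" "linear (B c)" for b c
    using B by (auto simp: bilinear_def)
  have "linear T" unfolding T_def
    by (rule linearI) (simp_all add: linear_add[OF linB(1)] linear_cmul[OF linB(1)] scaleR_add_left sum.distrib scaleR_sum_right)
  have agree: "g y = h y" if "\<And>b. b \<in> N \<Longrightarrow> g b = h b" "linear g" "linear h" "y \<in> E" for g h :: "'a \<Rightarrow> real" and y
    using linear_eq_on_span[OF that(2,3), of N y] that N(6) by auto
  have coeff: "(\<forall>b\<in>N. g b = h b) \<longleftrightarrow> (\<Sum>b\<in>N. g b *\<^sub>R b) = (\<Sum>b\<in>N. h b *\<^sub>R b)" for g h :: "'a \<Rightarrow> real"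
  proof
    assume "(\<Sum>b\<in>N. g b *\<^sub>R b) = (\<Sum>b\<in>N. h b *\<^sub>R b)"
    then have "(\<Sum>b\<in>N. (g b - h b) *\<^sub>R b) = 0"
      by (simp add: scaleR_diff_left sum_subtractf)
    then show "\<forall>b\<in>N. g b = h b"
      using independentD[OF N(4) fin subset_refl, of "\<lambda>b. g b - h b"] by simp
  qed auto
  have inj: "inj_on T E"
  proof (rule inj_onI)
    fix c d assume cd: "c \<in> E" "d \<in> E" "T c = T d"
    then have "\<forall>b\<in>N. B c b = B d b" using coeff[of "B c" "B d"] by (simp add: T_def)
    \<comment> \<open>Agreement on the basis extends to all of \<open>E\<close>, so
      \<open>c - d\<close> may be paired with itself.\<close>
    then have "B c (c - d) = B d (c - d)"
      using agree[of "B c" "B d" "c - d"] linB cd E by (auto simp: subspace_diff)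
    then have "B (c - d) (c - d) = 0" by (simp add: linear_diff[OF linB(1)])
    then show "c = d" using nz[of "c - d"] cd E by (simp add: subspace_diff)
  qed
  have TE: "T ` E \<subseteq> E"
    using N(1) E by (auto simp: T_def intro!: subspace_sum subspace_scale)
  moreover have "dim (T ` E) = dim E"
    using dim_image_eq[OF \<open>linear T\<close>, of E] inj E by (simp add: span_eq_iff[THEN iffD2])
  ultimately have "T ` E = E"
    using subspace_dim_equal[OF linear_subspace_image[OF \<open>linear T\<close> E] E TE] by simp
  moreover have "(\<Sum>b\<in>N. f b *\<^sub>R b) \<in> E"
    using N(1) E by (auto intro!: subspace_sum subspace_scale)
  ultimately obtain c where c: "c \<in> E" "T c = (\<Sum>b\<in>N. f b *\<^sub>R b)"
    by (metis imageE)
  then have "\<forall>b\<in>N. B c b = f b" using coeff[of "B c" f] by (simp add: T_def)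
  then have Bc: "\<forall>y\<in>E. B c y = f y" using agree[of "B c" f] linB f by auto
  show ?thesis
  proof (rule ex1I[of _ c])
    fix d assume d: "d \<in> E \<and> (\<forall>y\<in>E. B d y = f y)"
    then have "B (d - c) (d - c) = 0"
      using Bc c(1) E by (simp add: linear_diff[OF linB(1)] subspace_diff)
    then show "d = c" using nz[of "d - c"] d c(1) E by (simp add: subspace_diff)
  qed (use c Bc in auto)
qed

text \<open>Bilinearity is required on an open neighbourhood, so that derivatives at
  \<open>x\<close> inherit it; the other properties are required at \<open>x\<close> only.
  Nondegeneracy concerns \<open>E\<close>, which is the whole plane for the surface and the subspace
  \<open>tangent_p\<close> of the matrices for the flag manifold.\<close>

locale coordinate_metric =
  fixes S E :: "'a::euclidean_space set" and h :: "'a \<Rightarrow> 'a \<Rightarrow> 'a \<Rightarrow> real" and x :: 'a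
  assumes S: "open S" "x \<in> S" and E: "subspace E"
    and bil: "\<And>p. p \<in> S \<Longrightarrow> bilinear (h p)"
    and diff: "\<And>v w. (\<lambda>p. h p v w) differentiable (at x)"
    and nondeg: "\<And>c. c \<in> E \<Longrightarrow> h x c c = 0 \<Longrightarrow> c = 0"
begin

definition koszul :: "'a \<Rightarrow> 'a \<Rightarrow> 'a \<Rightarrow> real" where
  "koszul v w y = (Df (\<lambda>p. h p w y) x v + Df (\<lambda>p. h p v y) x w - Df (\<lambda>p. h p v w) x y) / 2"

lemma Df_has_derivative: "((\<lambda>p. h p v w) has_derivative Df (\<lambda>p. h p v w) x) (at x)"
  using diff by (simp add: frechet_derivative_works)

lemma Df_add_right: "Df (\<lambda>p. h p v (w + w')) x d = Df (\<lambda>p. h p v w) x d + Df (\<lambda>p. h p v w') x d"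
proof -
  have "((\<lambda>p. h p v w + h p v w') has_derivative (\<lambda>d. Df (\<lambda>p. h p v w) x d + Df (\<lambda>p. h p v w') x d)) (at x)"
    by (intro has_derivative_add Df_has_derivative)
  then have "((\<lambda>p. h p v (w + w')) has_derivative (\<lambda>d. Df (\<lambda>p. h p v w) x d + Df (\<lambda>p. h p v w') x d)) (at x)"
    by (rule has_derivative_transform_within_open[OF _ S]) (simp add: bilinear_radd[OF bil])
  then show ?thesis by (rule frechet_derivative_eqI)
qed

lemma Df_scale_right: "Df (\<lambda>p. h p v (r *\<^sub>R w)) x d = r * Df (\<lambda>p. h p v w) x d"
proof -
  have "((\<lambda>p. r * h p v w) has_derivative (\<lambda>d. r * Df (\<lambda>p. h p v w) x d)) (at x)"
    by (intro has_derivative_mult_right Df_has_derivative)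
  then have "((\<lambda>p. h p v (r *\<^sub>R w)) has_derivative (\<lambda>d. r * Df (\<lambda>p. h p v w) x d)) (at x)"
    by (rule has_derivative_transform_within_open[OF _ S]) (simp add: bilinear_rmul[OF bil])
  then show ?thesis by (rule frechet_derivative_eqI)
qed

lemma Df_scale_left: "Df (\<lambda>p. h p (r *\<^sub>R v) w) x d = r * Df (\<lambda>p. h p v w) x d"
proof -
  have "((\<lambda>p. r * h p v w) has_derivative (\<lambda>d. r * Df (\<lambda>p. h p v w) x d)) (at x)"
    by (intro has_derivative_mult_right Df_has_derivative)
  then have "((\<lambda>p. h p (r *\<^sub>R v) w) has_derivative (\<lambda>d. r * Df (\<lambda>p. h p v w) x d)) (at x)"
    by (rule has_derivative_transform_within_open[OF _ S]) (simp add: bilinear_lmul[OF bil])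
  then show ?thesis by (rule frechet_derivative_eqI)
qed

lemma linear_koszul: "linear (koszul v w)"
proof (rule linearI)
  note lin = linear_frechet_derivative[OF diff[of v w]]
  show "koszul v w (y + y') = koszul v w y + koszul v w y'" for y y'
    unfolding koszul_def Df_add_right linear_add[OF lin] by (simp add: add_divide_distrib diff_divide_distrib)
  show "koszul v w (r *\<^sub>R y) = r *\<^sub>R koszul v w y" for r y
    unfolding koszul_def Df_scale_right linear_cmul[OF lin] by (simp add: right_diff_distrib distrib_left)
qed

lemma christoffel_ex1: "\<exists>!c. c \<in> E \<and> (\<forall>y\<in>E. h x c y = koszul v w y)"
  by (rule subspace_riesz_representation[OF E bil[OF S(2)] nondeg linear_koszul])

lemma christoffel_koszul:
  "christoffel E h x v w \<in> E" "y \<in> E \<Longrightarrow> h x (christoffel E h x v w) y = koszul v w y"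
  using theI'[OF christoffel_ex1[of v w]] unfolding christoffel_def koszul_def by blast+

lemma christoffel_eqI: "c \<in> E \<Longrightarrow> (\<And>y. y \<in> E \<Longrightarrow> h x c y = koszul v w y) \<Longrightarrow> christoffel E h x v w = c"
  using christoffel_ex1[of v w] christoffel_koszul by blast

lemma christoffel_scale_right: "christoffel E h x v (r *\<^sub>R w) = r *\<^sub>R christoffel E h x v w"
proof (rule christoffel_eqI)
  show "r *\<^sub>R christoffel E h x v w \<in> E" using E christoffel_koszul by (simp add: subspace_scale)
  fix y assume "y \<in> E"
  then show "h x (r *\<^sub>R christoffel E h x v w) y = koszul v (r *\<^sub>R w) y"
    using linear_frechet_derivative[OF diff[of v y]]
    by (simp add: bilinear_lmul[OF bil[OF S(2)]] christoffel_koszul)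
      (simp add: koszul_def Df_scale_right Df_scale_left linear_cmul field_simps)
qed

end

section \<open>The tension of a map from a surface\<close>

lemma invariant_bilinear_complex:
  fixes b :: "complex \<Rightarrow> complex \<Rightarrow> real"
  assumes b: "bilinear b" and sym: "\<And>v w. b v w = b w v" and inv: "\<And>v w. b (\<i> * v) (\<i> * w) = b v w"
  shows "b v w = b 1 1 * (v \<bullet> w)"
proof -
  \<comment> \<open>Rotation by \<i> sends the pair of 1 and \<i> to that of \<i> and -1, so
    invariance and symmetry force the mixed value to be zero and the diagonal values to be
    equal.\<close>
  have ii: "b \<i> \<i> = b 1 1" using inv[of 1 1] by simp
  have "b 1 \<i> = b \<i> (\<i> * \<i>)" using inv[of 1 \<i>] by simp
  also have "\<dots> = - b \<i> 1" using bilinear_rneg[OF b, of \<i> 1] by simp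
  finally have 0: "b 1 \<i> = 0" "b \<i> 1 = 0" using sym[of 1 \<i>] by linarith+
  have exp: "z = Re z *\<^sub>R 1 + Im z *\<^sub>R \<i>" for z by (simp add: complex_eq_iff)
  have "b v w = b (Re v *\<^sub>R 1 + Im v *\<^sub>R \<i>) (Re w *\<^sub>R 1 + Im w *\<^sub>R \<i>)"
    by (metis exp)
  also have "\<dots> = Re v * (Re w * b 1 1) + Im v * (Im w * b \<i> \<i>)"
    unfolding bilinear_ladd[OF b] bilinear_radd[OF b] bilinear_lmul[OF b] bilinear_rmul[OF b]
    by (simp add: 0)
  finally show ?thesis by (simp add: ii inner_complex_def algebra_simps)
qed

text \<open>For a metric conformal to the Euclidean one of the plane, the trace of the Christoffel symbols vanishes.\<close>

lemma tension_surface: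
  fixes u :: "complex \<Rightarrow> 'b::euclidean_space"
  assumes D: "open D" "x \<in> D"
    and h: "\<And>v w. smooth_on D (\<lambda>p. h p v w)" "\<And>p. p \<in> D \<Longrightarrow> bilinear (h p)"
    "\<And>p v w. p \<in> D \<Longrightarrow> h p v w = h p w v" "\<And>p v. p \<in> D \<Longrightarrow> v \<noteq> 0 \<Longrightarrow> h p v v > 0"
    "\<And>p v w. p \<in> D \<Longrightarrow> h p (\<i> * v) (\<i> * w) = h p v w"
    and u: "\<And>p. p \<in> D' \<Longrightarrow> u differentiable (at p)" "\<And>v. (\<lambda>p. Df u p v) differentiable (at x)"
    and D': "open D'" "x \<in> D'"
    and g: "coordinate_metric S E g (u x)"
  shows "tension E h g u x = (1 / h x 1 1) *\<^sub>R
    (Df (\<lambda>p. Df u p 1) x 1 + Df (\<lambda>p. Df u p \<i>) x \<i>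
       + christoffel E g (u x) (Df u x 1) (Df u x 1) + christoffel E g (u x) (Df u x \<i>) (Df u x \<i>))"
proof -
  interpret g: coordinate_metric S E g "u x" by (rule g)
  interpret h: coordinate_metric D UNIV h x
  proof
    show "(\<lambda>p. h p v w) differentiable at x" for v w
      using h(1) D(2) by (rule smooth_on_differentiable)
    show "c = 0" if "h x c c = 0" for c
      using h(4)[OF D(2), of c] that by fastforce
  qed (use D h(2) in auto)
  define \<rho> where "\<rho> p = h p 1 1" for p
  have conf: "h p v w = \<rho> p * (v \<bullet> w)" if "p \<in> D" for p v w
    unfolding \<rho>_def using h(2,3,5) that by (intro invariant_bilinear_complex)
  have \<rho>pos: "\<rho> x > 0" using h(4)[OF D(2), of 1] by (simp add: \<rho>_def)
  have raise: "raise_index (h x) b = (1 / \<rho> x) *\<^sub>R b" for b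
    unfolding raise_index_def
  proof (rule the_equality)
    show "\<forall>w. h x ((1 / \<rho> x) *\<^sub>R b) w = b \<bullet> w" using \<rho>pos by (simp add: conf[OF D(2)])
    fix c assume "\<forall>w. h x c w = b \<bullet> w"
    then have "(\<rho> x *\<^sub>R c) \<bullet> w = b \<bullet> w" for w by (simp add: conf[OF D(2)])
    then have "\<rho> x *\<^sub>R c = b" by (metis inner_commute vector_eq_ldot)
    then show "c = (1 / \<rho> x) *\<^sub>R b" using \<rho>pos by auto
  qed
  have \<rho>diff: "(\<rho> has_derivative Df \<rho> x) (at x)"
    using h.Df_has_derivative[of 1 1] by (simp add: \<rho>_def[abs_def])
  have Dh: "Df (\<lambda>p. h p v w) x d = (v \<bullet> w) * Df \<rho> x d" for v w d
  proof -
    have "((\<lambda>p. (v \<bullet> w) * \<rho> p) has_derivative (\<lambda>d. (v \<bullet> w) * Df \<rho> x d)) (at x)"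
      by (intro has_derivative_mult_right \<rho>diff)
    then have "((\<lambda>p. h p v w) has_derivative (\<lambda>d. (v \<bullet> w) * Df \<rho> x d)) (at x)"
      by (rule has_derivative_transform_within_open[OF _ D]) (simp add: conf)
    then show ?thesis by (rule frechet_derivative_eqI)
  qed
  \<comment> \<open>Paired with \<open>y\<close>, the first two Koszul terms for 1 and \<i> add up
    to the differential of \<open>\<rho>\<close> at \<open>y\<close>. The last term subtracts half
    of that differential for each of the two directions, so the total is zero.\<close>
  have trace0: "christoffel UNIV h x 1 1 + christoffel UNIV h x \<i> \<i> = 0" (is "?c = 0")
  proof -
    have lin: "linear (Df \<rho> x)" using \<rho>diff by (rule has_derivative_linear)
    have "Df \<rho> x y = Re y * Df \<rho> x 1 + Im y * Df \<rho> x \<i>" for y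
    proof -
      have "y = Re y *\<^sub>R 1 + Im y *\<^sub>R \<i>" by (simp add: complex_eq_iff)
      then have "Df \<rho> x y = Df \<rho> x (Re y *\<^sub>R 1 + Im y *\<^sub>R \<i>)" by (rule arg_cong)
      then show ?thesis by (simp add: linear_add[OF lin] linear_cmul[OF lin])
    qed
    then have grad: "Df \<rho> x y = Re y * Df \<rho> x 1 + Im y * Df \<rho> x \<i>" for y .
    have "h x ?c y = 0" for y
      unfolding bilinear_ladd[OF h(2)[OF D(2)]] h.christoffel_koszul(2)[OF UNIV_I] h.koszul_def Dh grad[of y]
      by (simp add: inner_complex_def diff_divide_distrib)
    then show ?thesis using h.nondeg by blast
  qed
  \<comment> \<open>The raised vector is fixed at \<open>x\<close>, so the factor
    \<open>1 / \<rho> x\<close> is a constant and no derivative of \<open>\<rho>\<close> arises from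
    it.\<close>
  have second: "second_fundamental_form E h g u x b (raise_index (h x) b) =
     (1 / \<rho> x) *\<^sub>R (Df (\<lambda>p. Df u p b) x b - Df u x (christoffel UNIV h x b b)
        + christoffel E g (u x) (Df u x b) (Df u x b))" for b
  proof -
    have lin: "linear (Df u p)" if "p \<in> D'" for p using u(1)[OF that] by (rule linear_frechet_derivative)
    have "((\<lambda>p. (1 / \<rho> x) *\<^sub>R Df u p b) has_derivative (\<lambda>d. (1 / \<rho> x) *\<^sub>R Df (\<lambda>p. Df u p b) x d)) (at x)"
      using u(2)[of b] by (intro has_derivative_scaleR_right) (simp add: frechet_derivative_works)
    then have "((\<lambda>p. Df u p ((1 / \<rho> x) *\<^sub>R b)) has_derivative (\<lambda>d. (1 / \<rho> x) *\<^sub>R Df (\<lambda>p. Df u p b) x d)) (at x)"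
      by (rule has_derivative_transform_within_open[OF _ D']) (simp only: linear_cmul[OF lin])
    then have "Df (\<lambda>p. Df u p ((1 / \<rho> x) *\<^sub>R b)) x b = (1 / \<rho> x) *\<^sub>R Df (\<lambda>p. Df u p b) x b"
      by (rule frechet_derivative_eqI)
    then show ?thesis
      unfolding second_fundamental_form_def raise h.christoffel_scale_right linear_cmul[OF lin[OF D'(2)]]
        g.christoffel_scale_right
      by (simp only: scaleR_add_right scaleR_diff_right)
  qed
  have "linear (Df u x)" using u(1)[OF D'(2)] by (rule linear_frechet_derivative)
  then have "Df u x (christoffel UNIV h x 1 1) + Df u x (christoffel UNIV h x \<i> \<i>) = 0"
    using trace0 by (metis linear_add linear_0)
  then have eq: "Df u x (christoffel UNIV h x 1 1) = - Df u x (christoffel UNIV h x \<i> \<i>)"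
    by (simp add: eq_neg_iff_add_eq_0)
  show ?thesis
    unfolding tension_def second Basis_complex_def \<rho>_def[symmetric]
    by (simp add: eq scaleR_add_right scaleR_diff_right)
qed

section \<open>Moving frames on the flag manifold\<close>

lemma bounded_bilinear_matrix_mult:
  "bounded_bilinear ((**) :: 'n::finite cmat \<Rightarrow> 'n cmat \<Rightarrow> 'n cmat)"
  unfolding bilinear_conv_bounded_bilinear[symmetric] bilinear_def
  by (auto intro!: linearI simp: matrix_matrix_mult_def vec_eq_iff sum.distrib scaleR_sum_right algebra_simps)

lemma bounded_linear_adjoint_mat: "bounded_linear (adjoint_mat :: 'n::finite cmat \<Rightarrow> 'n cmat)"
  unfolding linear_conv_bounded_linear[symmetric]
  by (rule linearI) (simp_all add: adjoint_mat_simps)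

lemma bounded_linear_off_diagonal: "bounded_linear (off_diagonal :: 'n::finite cmat \<Rightarrow> 'n cmat)"
  unfolding linear_conv_bounded_linear[symmetric]
  by (rule linearI) (simp_all add: off_diagonal_def vec_eq_iff)

lemma bounded_linear_J_flag: "bounded_linear (J_flag k :: 'n::{finite,linorder} cmat \<Rightarrow> 'n cmat)"
  unfolding linear_conv_bounded_linear[symmetric]
  by (rule linearI) (simp_all add: J_flag_def J_upper_def vec_eq_iff algebra_simps)

lemma bounded_bilinear_ds2:
  "bounded_bilinear (ds2 \<Lambda> :: 'n::{finite,linorder} cmat \<Rightarrow> 'n cmat \<Rightarrow> real)"
  unfolding bilinear_conv_bounded_bilinear[symmetric] bilinear_def
  by (auto intro!: linearI simp: ds2_altdef sum.distrib[symmetric] sum_distrib_left algebra_simps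
      simp del: sum.distrib)

lemma ds2_sym: "ds2 \<Lambda> A B = ds2 \<Lambda> B A"
  by (simp add: ds2_altdef mult.commute)

text \<open>All summands are nonnegative, so each is zero. Diagonal entries have weight zero and are
  controlled by membership in \<open>tangent_p\<close> instead.\<close>

lemma ds2_nondegenerate:
  fixes A :: "'n::{finite,linorder} cmat"
  assumes \<Lambda>: "metric_matrix CARD('n) \<Lambda>" and A: "A \<in> tangent_p" and 0: "ds2 \<Lambda> A A = 0"
  shows "A = 0"
proof -
  let ?f = "\<lambda>i j. \<Lambda> (pos i) (pos j) * Re (A $ i $ j * cnj (A $ i $ j))"
  have pos: "\<Lambda> (pos i) (pos j) > 0" if "i \<noteq> j" for i j :: 'n
    using \<Lambda> that pos_bounds[of i] pos_bounds[of j] by (auto simp: metric_matrix_def)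
  have sq: "Re (z * cnj z) = (norm z)\<^sup>2" for z
    by (simp add: complex_mult_cnj cmod_power2)
  have nn: "?f i j \<ge> 0" for i j
    unfolding sq using pos[of i j] A by (cases "i = j") (auto simp: tangent_p_def)
  have "(\<Sum>i\<in>UNIV. \<Sum>j\<in>UNIV. ?f i j) = 0" using 0 by (simp only: ds2_altdef)
  then have z: "?f i j = 0" for i j
    using nn by (simp only: sum_nonneg_eq_0_iff sum_nonneg finite UNIV_I simp_thms Ball_def)
  have "A $ i $ j = 0" for i j
    using z[of i j] pos[of i j] A unfolding sq by (cases "i = j") (auto simp: tangent_p_def)
  then show ?thesis by (simp add: vec_eq_iff)
qed

lemma subspace_tangent_p: "subspace tangent_p"
  by (auto simp: subspace_def tangent_p_def adjoint_mat_def vec_eq_iff)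

text \<open>The map \<open>P\<close> is a linear projection onto \<open>tangent_p\<close>. On
  \<open>S\<close> the function equals its own projection, so its derivative lies in the range of
  \<open>P\<close>.\<close>

lemma Df_in_tangent_p:
  fixes f :: "'a::real_normed_vector \<Rightarrow> 'n::finite cmat"
  assumes S: "open S" "x \<in> S" and f: "\<And>y. y \<in> S \<Longrightarrow> f y \<in> tangent_p" and d: "f differentiable (at x)"
  shows "Df f x v \<in> tangent_p"
proof -
  define P :: "'n cmat \<Rightarrow> 'n cmat" where "P A = (1/2) *\<^sub>R off_diagonal (A - adjoint_mat A)" for A
  have lin: "bounded_linear P"
    unfolding linear_conv_bounded_linear[symmetric]
    by (rule linearI) (simp_all add: P_def off_diagonal_def adjoint_mat_def vec_eq_iff algebra_simps)
  have id: "P A = A" if "A \<in> tangent_p" for A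
    using that by (auto simp: P_def tangent_p_def off_diagonal_def vec_eq_iff)
  have ran: "P A \<in> tangent_p" for A
    by (auto simp: P_def tangent_p_def off_diagonal_def adjoint_mat_def vec_eq_iff scaleR_diff_right)
  have "((\<lambda>y. P (f y)) has_derivative (\<lambda>v. P (Df f x v))) (at x)"
    using d by (intro bounded_linear.has_derivative[OF lin]) (simp add: frechet_derivative_works)
  then have "(f has_derivative (\<lambda>v. P (Df f x v))) (at x)"
    by (rule has_derivative_transform_within_open[OF _ S]) (simp add: id f)
  then have "Df f x v = P (Df f x v)" by (rule frechet_derivative_eqI)
  then show ?thesis using ran by metis
qed

section \<open>The Maurer-Cartan form and the Levi-Civita connection in a local
  parametrization\<close>

definition maurer_cartan :: "('n::finite cmat \<Rightarrow> 'n cmat) \<Rightarrow> 'n cmat \<Rightarrow> 'n cmat \<Rightarrow> 'n cmat" where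
  "maurer_cartan s p v = adjoint_mat (s p) ** Df s p v"

definition Df_frame :: "('n::finite cmat \<Rightarrow> 'n cmat) \<Rightarrow> 'n cmat \<Rightarrow> 'n cmat \<Rightarrow> 'n cmat \<Rightarrow> 'n cmat" where
  "Df_frame s p v w = Df (\<lambda>q. frame_coord s q w) p v"

lemma frame_coord_maurer_cartan: "frame_coord s p v = off_diagonal (maurer_cartan s p v)"
  by (simp add: frame_coord_def maurer_cartan_def)

lemma linear_frame_coord:
  assumes "s differentiable (at p)"
  shows "linear (frame_coord s p)"
proof -
  have "linear (Df s p)" using assms by (rule linear_frechet_derivative)
  then show ?thesis
    unfolding frame_coord_def
    using linear_compose[OF linear_compose[OF _ bounded_linear.linear[OF bounded_bilinear.bounded_linear_right[OF bounded_bilinear_matrix_mult]]]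
        bounded_linear.linear[OF bounded_linear_off_diagonal]]
    by (simp add: o_def)
qed

locale flag_chart =
  fixes W :: "'n::{finite,linorder} cmat set" and s :: "'n cmat \<Rightarrow> 'n cmat"
  assumes param: "flag_param (W, s)"
begin

lemma W: "open W" and s: "smooth_on W s"
  and unitary: "\<And>x. x \<in> W \<Longrightarrow> x \<in> tangent_p \<Longrightarrow> s x \<in> unitary_group"
  and bij: "\<And>x. x \<in> W \<Longrightarrow> x \<in> tangent_p \<Longrightarrow> bij_betw (frame_coord s x) tangent_p tangent_p"
  using param by (auto simp: flag_param_def)

lemma s_derivative: "p \<in> W \<Longrightarrow> (s has_derivative Df s p) (at p)"
  using smooth_on_differentiable[OF s] by (simp add: frechet_derivative_works)

lemma maurer_cartan_derivative:
  assumes "p \<in> W"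
  shows "((\<lambda>q. maurer_cartan s q w) has_derivative
    (\<lambda>v. adjoint_mat (s p) ** Df (\<lambda>q. Df s q w) p v + adjoint_mat (Df s p v) ** Df s p w)) (at p)"
  unfolding maurer_cartan_def
  using smooth_on_differentiable[OF smooth_on_Df[OF s] assms, of w]
  by (intro bounded_bilinear.FDERIV[OF bounded_bilinear_matrix_mult]
      bounded_linear.has_derivative[OF bounded_linear_adjoint_mat] s_derivative assms)
    (simp add: frechet_derivative_works)

lemma frame_coord_derivative:
  assumes "p \<in> W"
  shows "((\<lambda>q. frame_coord s q w) has_derivative (\<lambda>v. Df_frame s p v w)) (at p)"
    "Df_frame s p v w = off_diagonal (adjoint_mat (s p) ** Df (\<lambda>q. Df s q w) p v + adjoint_mat (Df s p v) ** Df s p w)"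
proof -
  have *: "((\<lambda>q. frame_coord s q w) has_derivative
    (\<lambda>v. off_diagonal (adjoint_mat (s p) ** Df (\<lambda>q. Df s q w) p v + adjoint_mat (Df s p v) ** Df s p w))) (at p)"
    unfolding frame_coord_maurer_cartan
    by (rule bounded_linear.has_derivative[OF bounded_linear_off_diagonal maurer_cartan_derivative[OF assms]])
  show eq: "Df_frame s p v w = off_diagonal (adjoint_mat (s p) ** Df (\<lambda>q. Df s q w) p v + adjoint_mat (Df s p v) ** Df s p w)" for v
    unfolding Df_frame_def by (rule frechet_derivative_eqI[OF *])
  show "((\<lambda>q. frame_coord s q w) has_derivative (\<lambda>v. Df_frame s p v w)) (at p)"
    using * unfolding eq .
qed

text \<open>This differentiates the relation that \<open>s\<close> is unitary. The relation is
  available only on the part of \<open>W\<close> in \<open>tangent_p\<close>, hence the restriction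
  to directions \<open>v\<close> of that subspace and the passage to the line
  \<open>c\<close>.\<close>

lemma adjoint_Df_unitary:
  assumes p: "p \<in> W" "p \<in> tangent_p" and v: "v \<in> tangent_p"
  shows "adjoint_mat (Df s p v) ** s p = - maurer_cartan s p v"
proof -
  define c where "c t = p + t *\<^sub>R v" for t :: real
  have c: "(c has_derivative (\<lambda>t. t *\<^sub>R v)) (at 0)"
    unfolding c_def by (auto intro!: derivative_eq_intros)
  have sc: "((\<lambda>t. s (c t)) has_derivative (\<lambda>t. Df s p (t *\<^sub>R v))) (at 0)"
    using has_derivative_compose[OF c, of s "Df s p"] s_derivative[OF p(1)] by (simp add: c_def)
  have "((\<lambda>t. adjoint_mat (s (c t)) ** s (c t)) has_derivative
     (\<lambda>t. adjoint_mat (s (c 0)) ** Df s p (t *\<^sub>R v) + adjoint_mat (Df s p (t *\<^sub>R v)) ** s (c 0))) (at 0)"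
    by (intro bounded_bilinear.FDERIV[OF bounded_bilinear_matrix_mult]
        bounded_linear.has_derivative[OF bounded_linear_adjoint_mat] sc)
  moreover have "open (c -` W)"
    unfolding c_def by (intro open_vimage W continuous_intros)
  ultimately have "((\<lambda>t. mat 1) has_derivative
     (\<lambda>t. adjoint_mat (s (c 0)) ** Df s p (t *\<^sub>R v) + adjoint_mat (Df s p (t *\<^sub>R v)) ** s (c 0))) (at 0)"
  proof (rule has_derivative_transform_within_open)
    fix t assume "t \<in> c -` W"
    moreover have "c t \<in> tangent_p"
      using p(2) v subspace_tangent_p by (auto simp: c_def intro: subspace_add subspace_scale)
    ultimately show "adjoint_mat (s (c t)) ** s (c t) = mat 1"
      using unitary[of "c t"] by (auto simp: unitary_group_def)
  qed (use p in \<open>simp add: c_def\<close>)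
  then have "Df (\<lambda>t::real. mat 1 :: 'n cmat) 0 1
     = adjoint_mat (s (c 0)) ** Df s p (1 *\<^sub>R v) + adjoint_mat (Df s p (1 *\<^sub>R v)) ** s (c 0)"
    by (rule frechet_derivative_eqI)
  then have "maurer_cartan s p v + adjoint_mat (Df s p v) ** s p = 0"
    by (simp add: c_def maurer_cartan_def)
  then show ?thesis by (simp add: eq_neg_iff_add_eq_0 add.commute)
qed

lemma maurer_cartan_skew_hermitian:
  "p \<in> W \<Longrightarrow> p \<in> tangent_p \<Longrightarrow> v \<in> tangent_p \<Longrightarrow> maurer_cartan s p v \<in> skew_hermitian"
  using adjoint_Df_unitary[of p v]
  by (simp add: skew_hermitian_def maurer_cartan_def adjoint_mat_mult adjoint_mat_simps)

text \<open>The structure equation \<open>d\<omega> + \<omega> \<and> \<omega> = 0\<close>.\<close>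

lemma Df_frame_commute:
  assumes p: "p \<in> W" "p \<in> tangent_p" and v: "v \<in> tangent_p" and w: "w \<in> tangent_p"
  shows "Df_frame s p v w - Df_frame s p w v = - off_diagonal (commutator_mat (maurer_cartan s p v) (maurer_cartan s p w))"
proof -
  have ss: "s p ** adjoint_mat (s p) = mat 1"
    using unitary[OF p] by (simp add: unitary_group_def)
  \<comment> \<open>Inserting \<open>s p ** adjoint_mat (s p)\<close> between the factors splits the
    product into two values of the form.\<close>
  have prod: "adjoint_mat (Df s p v) ** Df s p w = - (maurer_cartan s p v ** maurer_cartan s p w)"
    if "v \<in> tangent_p" for v w
  proof -
    have "adjoint_mat (Df s p v) ** Df s p w = adjoint_mat (Df s p v) ** (s p ** adjoint_mat (s p)) ** Df s p w"
      by (simp add: ss)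
    also have "\<dots> = (adjoint_mat (Df s p v) ** s p) ** (adjoint_mat (s p) ** Df s p w)"
      by (simp only: matrix_mul_assoc)
    finally show ?thesis
      by (simp only: adjoint_Df_unitary[OF p that] maurer_cartan_def[symmetric] matrix_mult_minus)
  qed
  have sym: "Df (\<lambda>q. Df s q w) p v = Df (\<lambda>q. Df s q v) p w"
    by (rule symmetric_second_derivative[OF W s p(1)])
  show ?thesis
    unfolding frame_coord_derivative(2)[OF p(1)] sym prod[OF v] prod[OF w] commutator_mat_def
    by (auto simp: off_diagonal_def vec_eq_iff)
qed

lemma bilinear_invariant_metric:
  assumes "p \<in> W"
  shows "bilinear (invariant_metric (ds2 \<Lambda>) (W, s) p)"
proof -
  have lin: "linear (frame_coord s p)"
    using smooth_on_differentiable[OF s assms] by (rule linear_frame_coord)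
  show ?thesis
    using bounded_bilinear_ds2[of \<Lambda>, where 'n = 'n] unfolding invariant_metric_def bilinear_def
    by (auto intro!: linearI simp: linear_add[OF lin] linear_cmul[OF lin]
        bounded_bilinear.add_left bounded_bilinear.add_right bounded_bilinear.scaleR_left bounded_bilinear.scaleR_right)
qed

lemma invariant_metric_derivative:
  assumes "p \<in> W"
  shows "((\<lambda>q. invariant_metric (ds2 \<Lambda>) (W, s) q v w) has_derivative
    (\<lambda>d. ds2 \<Lambda> (frame_coord s p v) (Df_frame s p d w) + ds2 \<Lambda> (Df_frame s p d v) (frame_coord s p w))) (at p)"
  unfolding invariant_metric_def split
  by (intro bounded_bilinear.FDERIV[OF bounded_bilinear_ds2] frame_coord_derivative(1) assms)

text \<open>Nondegeneracy is carried over from \<open>ds2\<close> by the bijectivity of the frame on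
  \<open>tangent_p\<close>.\<close>

lemma coordinate_metric_invariant_metric:
  assumes \<Lambda>: "metric_matrix CARD('n) \<Lambda>" and p: "p \<in> W" "p \<in> tangent_p"
  shows "coordinate_metric W tangent_p (invariant_metric (ds2 \<Lambda>) (W, s)) p"
proof
  show "c = 0" if "c \<in> tangent_p" "invariant_metric (ds2 \<Lambda>) (W, s) p c c = 0" for c
  proof -
    have lin: "linear (frame_coord s p)"
      using smooth_on_differentiable[OF s p(1)] by (rule linear_frame_coord)
    have "frame_coord s p c = 0"
      using that bij[OF p] by (intro ds2_nondegenerate[OF \<Lambda>]) (auto simp: invariant_metric_def bij_betw_def)
    then have "frame_coord s p c = frame_coord s p 0" by (simp add: linear_0[OF lin])
    then show "c = 0"
      using bij[OF p] that(1) subspace_0[OF subspace_tangent_p] by (auto simp: bij_betw_def inj_on_def)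
  qed
  show "(\<lambda>q. invariant_metric (ds2 \<Lambda>) (W, s) q v w) differentiable at p" for v w
    using invariant_metric_derivative[OF p(1)] unfolding differentiable_def by blast
qed (use W p subspace_tangent_p bilinear_invariant_metric in auto)

text \<open>For equal arguments the Koszul formula contains the derivative of the frame only through
  \<open>Df_frame s p v v\<close> and an antisymmetric difference, which the structure equation
  replaces by a commutator.\<close>

lemma ds2_Df_tangent:
  assumes \<Lambda>: "metric_matrix CARD('n) \<Lambda>" and p: "p \<in> W" "p \<in> tangent_p" and v: "v \<in> tangent_p" and y: "y \<in> tangent_p"
  shows "invariant_metric (ds2 \<Lambda>) (W, s) p (christoffel tangent_p (invariant_metric (ds2 \<Lambda>) (W, s)) p v v) y
    = ds2 \<Lambda> (Df_frame s p v v) (frame_coord s p y)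
      - ds2 \<Lambda> (frame_coord s p v) (off_diagonal (commutator_mat (maurer_cartan s p v) (maurer_cartan s p y)))"
proof -
  interpret g: coordinate_metric W tangent_p "invariant_metric (ds2 \<Lambda>) (W, s)" p
    by (rule coordinate_metric_invariant_metric[OF \<Lambda> p])
  interpret G: bounded_bilinear "ds2 \<Lambda> :: 'n cmat \<Rightarrow> _" by (rule bounded_bilinear_ds2)
  have "g.koszul v v y = ds2 \<Lambda> (Df_frame s p v v) (frame_coord s p y)
      + ds2 \<Lambda> (frame_coord s p v) (Df_frame s p v y - Df_frame s p y v)"
    unfolding g.koszul_def frechet_derivative_eqI[OF invariant_metric_derivative[OF p(1)]] G.diff_right
      ds2_sym[of \<Lambda> "Df_frame s p y v"] by simp
  then show ?thesis
    unfolding g.christoffel_koszul(2)[OF y] Df_frame_commute[OF p v y] G.minus_right by simp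
qed

text \<open>The trace lies in \<open>tangent_p\<close>, so it suffices to pair it with every
  \<open>y\<close> there. The pairing combines derivatives of frame components, which holomorphy
  expresses by a commutator, with the commutator terms of the connection;
  \<open>ds2_J_flag_commutator\<close> says that these cancel.\<close>

lemma trace_second_derivative_holomorphic:
  assumes \<Lambda>: "type_Lambda CARD('n) k \<Lambda>" and k: "k \<le> CARD('n) - 3"
    and D: "open D" "x \<in> D" and u: "smooth_on D u"
    and range: "\<And>y. y \<in> D \<Longrightarrow> u y \<in> W" "\<And>y. y \<in> D \<Longrightarrow> u y \<in> tangent_p"
    and hol: "\<And>y v. y \<in> D \<Longrightarrow> Df u y (\<i> * v) = invariant_acs (J_flag k) (W, s) (u y) (Df u y v)"
  defines "\<Gamma> \<equiv> christoffel tangent_p (invariant_metric (ds2 \<Lambda>) (W, s)) (u x)"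
  shows "Df (\<lambda>p. Df u p 1) x 1 + Df (\<lambda>p. Df u p \<i>) x \<i>
       + \<Gamma> (Df u x 1) (Df u x 1) + \<Gamma> (Df u x \<i>) (Df u x \<i>) = 0" (is "?T = 0")
proof -
  define F where "F = frame_coord s"
  define A where "A = maurer_cartan s (u x)"
  \<comment> \<open>The product rule for \<open>F (u y) (Df u y e)\<close>, differentiated at
    \<open>x\<close> in the direction \<open>d\<close>.\<close>
  define Z where "Z d e = Df_frame s (u x) (Df u x d) (Df u x e) + F (u x) (Df (\<lambda>p. Df u p e) x d)" for d e
  have q: "u x \<in> W" "u x \<in> tangent_p" using range D(2) by auto
  have mm: "metric_matrix CARD('n) \<Lambda>" using \<Lambda> by (simp add: type_Lambda_def)
  interpret g: coordinate_metric W tangent_p "invariant_metric (ds2 \<Lambda>) (W, s)" "u x"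
    by (rule coordinate_metric_invariant_metric[OF mm q])
  interpret G: bounded_bilinear "ds2 \<Lambda> :: 'n cmat \<Rightarrow> _" by (rule bounded_bilinear_ds2)
  have F_mem: "F p v \<in> tangent_p" if "p \<in> W" "p \<in> tangent_p" "v \<in> tangent_p" for p v
    using bij[OF that(1,2)] that(3) by (auto simp: F_def bij_betw_def)
  have linF: "linear (F p)" if "p \<in> W" for p
    unfolding F_def using smooth_on_differentiable[OF s that] by (rule linear_frame_coord)
  have Du_mem: "Df u y v \<in> tangent_p" if "y \<in> D" for y v
    by (rule Df_in_tangent_p[OF D(1) that range(2) smooth_on_differentiable[OF u that]])
  have D2u_mem: "Df (\<lambda>p. Df u p v) x w \<in> tangent_p" for v w
    by (rule Df_in_tangent_p[OF D Du_mem smooth_on_differentiable[OF smooth_on_Df[OF u] D(2)]])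
  \<comment> \<open>The frame maps \<open>tangent_p\<close> onto itself, so applying it undoes the
    \<open>inv_into\<close> in \<open>invariant_acs\<close>.\<close>
  have J_frame: "F (u y) (Df u y \<i>) = J_flag k (F (u y) (Df u y 1))" if "y \<in> D" for y
  proof -
    have "F (u y) ` tangent_p = tangent_p"
      using bij[OF range(1)[OF that] range(2)[OF that]] by (simp add: F_def bij_betw_def)
    then have "F (u y) (inv_into tangent_p (F (u y)) (J_flag k (F (u y) (Df u y 1)))) = J_flag k (F (u y) (Df u y 1))"
      by (intro f_inv_into_f) (simp add: J_flag_in_tangent_p)
    then show ?thesis
      using hol[OF that, of 1] by (simp add: invariant_acs_def F_def)
  qed
  have Z: "((\<lambda>y. F (u y) (Df u y e)) has_derivative (\<lambda>d. Z d e)) (at x)" for e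
    unfolding Z_def Df_frame_def F_def[symmetric]
  proof (rule has_derivative_linear_family[where S = W and L = F and u = u and c = "\<lambda>y. Df u y e"])
    show "(\<lambda>p. F p v) differentiable at (u x)" for v
      using frame_coord_derivative(1)[OF q(1)] unfolding F_def differentiable_def by blast
    show "open W" "u x \<in> W" "\<And>p. p \<in> W \<Longrightarrow> linear (F p)" by (fact W q(1) linF)+
    show "(u has_derivative Df u x) (at x)" "((\<lambda>y. Df u y e) has_derivative Df (\<lambda>p. Df u p e) x) (at x)"
      using smooth_on_differentiable[OF u D(2)] smooth_on_differentiable[OF smooth_on_Df[OF u] D(2)]
      by (simp_all add: frechet_derivative_works)
  qed
  have Z_mem: "Z d 1 \<in> tangent_p" for d
  proof -
    have "Df (\<lambda>y. F (u y) (Df u y 1)) x d \<in> tangent_p"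
    proof (rule Df_in_tangent_p[OF D])
      show "F (u y) (Df u y 1) \<in> tangent_p" if "y \<in> D" for y
        using that by (intro F_mem range Du_mem)
      show "(\<lambda>y. F (u y) (Df u y 1)) differentiable (at x)"
        using Z[of 1] unfolding differentiable_def by blast
    qed
    then show ?thesis unfolding frechet_derivative_eqI[OF Z] .
  qed
  \<comment> \<open>The relation \<open>J_frame\<close> holds on all of the open set
    \<open>D\<close> and \<open>J_flag k\<close> is a fixed linear map, so the relation may be
    differentiated.\<close>
  have JZ: "Z d \<i> = J_flag k (Z d 1)" for d
  proof -
    have "((\<lambda>y. J_flag k (F (u y) (Df u y 1))) has_derivative (\<lambda>d. J_flag k (Z d 1))) (at x)"
      by (rule bounded_linear.has_derivative[OF bounded_linear_J_flag Z])
    then have "((\<lambda>y. F (u y) (Df u y \<i>)) has_derivative (\<lambda>d. J_flag k (Z d 1))) (at x)"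
      by (rule has_derivative_transform_within_open[OF _ D]) (simp add: J_frame)
    then have "Df (\<lambda>y. F (u y) (Df u y \<i>)) x d = J_flag k (Z d 1)"
      by (rule frechet_derivative_eqI)
    then show ?thesis unfolding frechet_derivative_eqI[OF Z] .
  qed
  define C where "C = off_diagonal (commutator_mat (A (Df u x 1)) (A (Df u x \<i>)))"
  \<comment> \<open>The structure equation on the images of 1 and \<i>; the second derivatives of
    \<open>u\<close> drop out by symmetry.\<close>
  have comm: "Z 1 \<i> = Z \<i> 1 - C"
    using Df_frame_commute[OF q Du_mem Du_mem, OF D(2) D(2), of 1 \<i>]
      symmetric_second_derivative[OF D(1) u D(2), of 1 \<i>]
    by (simp add: Z_def C_def A_def algebra_simps)
  \<comment> \<open>Since \<open>J_flag k\<close> squares to minus the identity on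
    \<open>tangent_p\<close>, applying it to \<open>comm\<close> trades the mixed derivatives for
    the pure ones.\<close>
  have Zsum: "Z 1 1 + Z \<i> \<i> = J_flag k C"
  proof -
    have lin: "linear (J_flag k :: 'n cmat \<Rightarrow> _)" by (rule bounded_linear.linear[OF bounded_linear_J_flag])
    have "- Z 1 1 = J_flag k (Z 1 \<i>)" unfolding JZ[of 1] J_flag_J_flag[OF Z_mem] ..
    also have "\<dots> = Z \<i> \<i> - J_flag k C" unfolding comm linear_diff[OF lin] JZ[of \<i>] ..
    finally show ?thesis by (simp add: algebra_simps)
  qed
  have T_mem: "?T \<in> tangent_p"
    using D2u_mem g.christoffel_koszul(1) subspace_tangent_p unfolding \<Gamma>_def by (auto intro!: subspace_add)
  have A_skew: "A v \<in> skew_hermitian" if "v \<in> tangent_p" for v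
    unfolding A_def by (rule maurer_cartan_skew_hermitian[OF q that])
  have FA: "F (u x) v = off_diagonal (A v)" for v
    by (simp add: F_def A_def frame_coord_maurer_cartan)
  let ?g = "invariant_metric (ds2 \<Lambda>) (W, s) (u x)"
  have "?g ?T y = 0" if y: "y \<in> tangent_p" for y
  proof -
    have \<Gamma>: "?g (\<Gamma> v v) y = ds2 \<Lambda> (Df_frame s (u x) v v) (F (u x) y)
        - ds2 \<Lambda> (F (u x) v) (off_diagonal (commutator_mat (A v) (A y)))" if "v \<in> tangent_p" for v
      unfolding \<Gamma>_def F_def A_def by (rule ds2_Df_tangent[OF mm q that y])
    have g: "?g v y = ds2 \<Lambda> (F (u x) v) (F (u x) y)" for v by (simp add: invariant_metric_def F_def)
    \<comment> \<open>The second derivatives of \<open>u\<close> and the terms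
      \<open>Df_frame s (u x) v v\<close> from \<open>\<Gamma>\<close> add up to
      \<open>Z 1 1 + Z \<i> \<i>\<close>.\<close>
    have "?g ?T y = ds2 \<Lambda> (Z 1 1 + Z \<i> \<i>) (F (u x) y)
        - (ds2 \<Lambda> (F (u x) (Df u x 1)) (off_diagonal (commutator_mat (A (Df u x 1)) (A y)))
         + ds2 \<Lambda> (F (u x) (Df u x \<i>)) (off_diagonal (commutator_mat (A (Df u x \<i>)) (A y))))"
      unfolding bilinear_ladd[OF g.bil[OF q(1)]] \<Gamma>[OF Du_mem[OF D(2)]]
      by (simp add: g Z_def G.add_left)
    also have "ds2 \<Lambda> (Z 1 1 + Z \<i> \<i>) (F (u x) y)
        = ds2 \<Lambda> (F (u x) (Df u x 1)) (off_diagonal (commutator_mat (A (Df u x 1)) (A y)))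
         + ds2 \<Lambda> (F (u x) (Df u x \<i>)) (off_diagonal (commutator_mat (A (Df u x \<i>)) (A y)))"
      unfolding Zsum C_def FA
      by (rule ds2_J_flag_commutator[OF \<Lambda> k])
        (use J_frame[OF D(2)] in \<open>simp_all add: FA A_skew Du_mem D y\<close>)
    finally show ?thesis by simp
  qed
  then show ?thesis using g.nondeg T_mem by blast
qed

end

section \<open>Passing to charts of the surface and the flag manifold\<close>

lemma holomorphic_atlas_chart:
  assumes "holomorphic_atlas X \<A>" "(U, z) \<in> \<A>"
  shows "inj_on z U" and "openin X V \<Longrightarrow> V \<subseteq> U \<Longrightarrow> open (z ` V)"
proof -
  have c: "openin X U" "open (z ` U)" "homeomorphic_map (subtopology X U) (top_of_set (z ` U)) z"
    using assms by (auto simp: holomorphic_atlas_def)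
  have "topspace X \<inter> U = U" using openin_subset[OF c(1)] by auto
  then show "inj_on z U" using homeomorphic_imp_injective_map[OF c(3)] by simp
  assume V: "openin X V" "V \<subseteq> U"
  then have "openin (subtopology X U) V" by (auto simp: openin_subtopology)
  then have "openin (top_of_set (z ` U)) (z ` V)"
    using homeomorphic_imp_open_map[OF c(3)] by (simp add: open_map_def)
  then show "open (z ` V)" using c(2) by (simp add: openin_open_eq)
qed

text \<open>Injectivity of \<open>z\<close> makes \<open>inv_into\<close> return the original point
  \<open>p\<close>, and membership in the overlap puts \<open>\<phi> p\<close> into the image of the
  parametrization, where the second \<open>inv_into\<close> takes a value in the right set.\<close>

lemma coord_map_range:
  assumes "inj_on z U" "x \<in> coord_domain \<phi> (U, z) (W, s)"
  shows "coord_map \<phi> (U, z) (W, s) x \<in> W" "coord_map \<phi> (U, z) (W, s) x \<in> tangent_p"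
proof -
  obtain p where p: "p \<in> U" "x = z p" "\<phi> p \<in> (\<lambda>x. torus_coset (s x)) ` (W \<inter> tangent_p)"
    using assms(2) by (auto simp: coord_domain_def chart_overlap_def)
  then have "coord_map \<phi> (U, z) (W, s) x \<in> W \<inter> tangent_p"
    using assms(1) by (simp only: coord_map_def split inv_into_f_f inv_into_into)
  then show "coord_map \<phi> (U, z) (W, s) x \<in> W" "coord_map \<phi> (U, z) (W, s) x \<in> tangent_p" by auto
qed

theorem proposition6p1:
  fixes X :: "'m topology" and \<A> :: "'m chart set"
    and h :: "'m chart \<Rightarrow> complex \<Rightarrow> complex \<Rightarrow> complex \<Rightarrow> real"
    and g :: "'n::{finite,linorder} cmat \<Rightarrow> 'n cmat \<Rightarrow> real"
    and \<Lambda> :: "nat \<Rightarrow> nat \<Rightarrow> real" and k :: nat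
    and \<phi> :: "'m \<Rightarrow> 'n cmat set"
  assumes "CARD('n) \<ge> 4"
    and "1 \<le> k" and "k \<le> CARD('n) - 3"
    and "g \<in> metrics_M" and "g = ds2 \<Lambda>" and "type_Lambda CARD('n) k \<Lambda>"
    and "closed_riemann_surface X \<A>" and "hermitian_metric \<A> h"
    and "holomorphic_to_flag X \<A> (J_flag k) \<phi>"
  shows "harmonic_to_flag X \<A> h g \<phi>"
proof -
  have smooth: "smooth_to_flag X \<A> \<phi>"
    using assms(9) by (simp add: holomorphic_to_flag_def)
  have "tension tangent_p (h c) (invariant_metric g q) (coord_map \<phi> c q) x = 0"
    if c: "c \<in> \<A>" and q: "flag_param q" and x: "x \<in> coord_domain \<phi> c q" for c q x
  proof -
    obtain U z W s where cq: "c = (U, z)" "q = (W, s)" by (metis surj_pair)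
    interpret flag_chart W s using q cq by unfold_locales simp
    define u where "u = coord_map \<phi> c q"
    define D where "D = coord_domain \<phi> c q"
    have atlas: "holomorphic_atlas X \<A>" using assms(7) by (simp add: closed_riemann_surface_def)
    note chart = holomorphic_atlas_chart[OF atlas c[unfolded cq]]
    have "chart_overlap \<phi> c q \<subseteq> U" by (auto simp: chart_overlap_def cq)
    moreover have "openin X (chart_overlap \<phi> c q)" and u: "smooth_on D u"
      using smooth c q unfolding smooth_to_flag_def u_def D_def by blast+
    \<comment> \<open>The continuity of \<open>\<phi>\<close> contained in
      \<open>smooth_to_flag\<close> makes the overlap open, and charts are open maps.\<close>
    ultimately have D: "open D" "D \<subseteq> z ` U" "x \<in> D"
      using chart(2) x by (auto simp: D_def coord_domain_def cq)
    have range: "u y \<in> W" "u y \<in> tangent_p" if "y \<in> D" for y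
      using coord_map_range[OF chart(1), of y \<phi> W s] that by (simp_all add: u_def D_def cq)
    have hol: "Df u y (\<i> * v) = invariant_acs (J_flag k) (W, s) (u y) (Df u y v)" if "y \<in> D" for y v
      using assms(9) c q that unfolding holomorphic_to_flag_def u_def D_def cq by blast
    have mm: "metric_matrix CARD('n) \<Lambda>" using assms(6) by (simp add: type_Lambda_def)
    have "open (z ` U)" using atlas c by (auto simp: holomorphic_atlas_def cq)
    then have "tension tangent_p (h c) (invariant_metric (ds2 \<Lambda>) (W, s)) u x = (1 / h c x 1 1) *\<^sub>R
      (Df (\<lambda>p. Df u p 1) x 1 + Df (\<lambda>p. Df u p \<i>) x \<i>
       + christoffel tangent_p (invariant_metric (ds2 \<Lambda>) (W, s)) (u x) (Df u x 1) (Df u x 1)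
       + christoffel tangent_p (invariant_metric (ds2 \<Lambda>) (W, s)) (u x) (Df u x \<i>) (Df u x \<i>))"
    \<comment> \<open>The metric is given on the image of the whole chart, the coordinate map only
      on \<open>D\<close>, so two open sets occur.\<close>
    proof (rule tension_surface[where D' = D])
      show "coordinate_metric W tangent_p (invariant_metric (ds2 \<Lambda>) (W, s)) (u x)"
        using range D(3) by (intro coordinate_metric_invariant_metric[OF mm]) auto
      show "u differentiable (at p)" if "p \<in> D" for p using u that by (rule smooth_on_differentiable)
      show "(\<lambda>p. Df u p v) differentiable (at x)" for v
        using smooth_on_Df[OF u] D(3) by (rule smooth_on_differentiable)
    qed (use assms(8) c D in \<open>auto simp: hermitian_metric_def cq\<close>)
    also have "\<dots> = 0"
      using trace_second_derivative_holomorphic[OF assms(6,3) D(1,3) u range hol] by simp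
    finally show ?thesis by (simp add: assms(5) u_def cq)
  qed
  with smooth show ?thesis by (simp add: harmonic_to_flag_def)
qed

end
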